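(* Let $d\ge1$, let $\lambda_0,\lambda_1,\ldots,\lambda_d\in\mathbb R\setminus\{0\}$ be such that either (A) all of them are positive, or (B) exactly one of them is negative, all others are positive and $\lambda_0+\cdots+\lambda_d<0$, and let $\varepsilon_1,\ldots,\varepsilon_d\in\{\pm1\}$. Then, for every $k\in\{0,\ldots,d\}$, the $k$-th conic intrinsic volume of the orthocentric cone $C_d(\lambda_0;\lambda_1,\ldots,\lambda_d;\varepsilon_1,\ldots,\varepsilon_d)$ is $$\upsilon_k(C_d(\lambda_0;\lambda_1,\ldots,\lambda_d;\varepsilon_1,\ldots,\varepsilon_d))=\sum_{1\le i_1<\cdots<i_k\le d}\mathbf g_k\bigl(-\lambda_0-\lambda_{i_1}-\cdots-\lambda_{i_k};\lambda_{i_1},\ldots,\lambda_{i_k};\varepsilon_{i_1}\operatorname{sgn}(\lambda_{i_1}),\ldots,\varepsilon_{i_k}\operatorname{sgn}(\lambda_{i_k})\bigr)$$ $$\qquad\qquad\times\ \mathbf g_{d-k}\bigl(\lambda_0+\lambda_{i_1}+\cdots+\lambda_{i_k};\lambda_{j_1},\ldots,\lambda_{j_{d-k}};\varepsilon_{j_1},\ldots,\varepsilon_{j_{d-k}}\bigr),$$ where $j_1,\ldots,j_{d-k}$ are defined via $\{i_1,\ldots,i_k\}\cup\{j_1,\ldots,j_{d-k}\}=\{1,\ldots,d\}$. In particular, since $\mathbf g_0=1$, for $k=0$ and $k=d$ this means $$\upsilon_0(C_d(\lambda_0;\lambda_1,\ldots,\lambda_d;\varepsilon_1,\ldots,\varepsilon_d))=\mathbf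 g_d(\lambda_0;\lambda_1,\ldots,\lambda_d;\varepsilon_1,\ldots,\varepsilon_d),$$ $$\upsilon_d(C_d(\lambda_0;\lambda_1,\ldots,\lambda_d;\varepsilon_1,\ldots,\varepsilon_d))=\mathbf g_d(-\lambda_0-\lambda_1-\cdots-\lambda_d;\lambda_1,\ldots,\lambda_d;\varepsilon_1\operatorname{sgn}(\lambda_1),\ldots,\varepsilon_d\operatorname{sgn}(\lambda_d)).$$
   Context: Conic intrinsic volumes: for a $d$-dimensional polyhedral cone $C\subseteq\mathbb R^N$ and $k\in\{0,\ldots,d\}$, $\upsilon_k(C)=\sum_F\mathbb P[\pi_C(g)\in\operatorname{relint}F]=\sum_F\alpha(F)\alpha(N(F,C))$, where the sums run over all $k$-dimensional faces $F$ of $C$, $g$ is a standard Gaussian vector in $\mathbb R^N$, $\pi_C(x)$ is the point of $C$ nearest to $x$, $\alpha(K)=\mathbb P[\xi\in K]$ ($\xi$ standard Gaussian on the linear hull of $K$) is the solid angle, and $N(F,C)=\{v\in\mathbb R^N:\langle v,z-x_0\rangle\le0\ \text{for all }z\in C\}$ (for any $x_0\in\operatorname{relint}F$) is the normal cone. Orthocentric cone: $C_d(\lambda_0;\lambda_1,\ldots,\lambda_d;\varepsilon_1,\ldots,\varepsilon_d):=\operatorname{pos}(\varepsilon_1v_1,\ldots,\varepsilon_dv_d)$ (positive hull), where $v_1,\ldots,v_d$ are linearly independent vectors in some $\mathbb R^N$, $N\ge d$, with $\langle v_i,v_j\rangle=\frac1{\lambda_0}+\frac{\delta_{ij}}{\lambda_i}$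 for all $i,j$. Such vectors exist exactly under (A) or (B), and the cone is defined up to isometry. Function $\mathbf g_m$: for $m\in\mathbb N$, nonzero real $\lambda_0,\ldots,\lambda_m$ satisfying (A) or (B) (with $d$ replaced by $m$) and $\varepsilon_1,\ldots,\varepsilon_m\in\{\pm1\}$, $\mathbf g_m(\lambda_0;\lambda_1,\ldots,\lambda_m;\varepsilon_1,\ldots,\varepsilon_m):=\mathbb P[\varepsilon_1\eta_1<0,\ldots,\varepsilon_m\eta_m<0]$, where $(\eta_1,\ldots,\eta_m)$ is centered Gaussian with covariance matrix $\bigl(\frac1{\lambda_0}+\frac{\delta_{ij}}{\lambda_i}\bigr)_{i,j=1}^m$. Also $\mathbf g_0(\lambda_0):=1$ for all $\lambda_0\in\mathbb R$. *)

theory Defs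
  imports "HOL-Probability.Probability"
begin

definition std_gaussian :: "'a::euclidean_space measure" where
  "std_gaussian =
     distr (\<Pi>\<^sub>M b\<in>Basis. std_normal_distribution) borel (\<lambda>x. \<Sum>b\<in>Basis. x b *\<^sub>R b)"

text \<open>
  The library also counts the empty set as a face; it has affine dimension -1 and hence does not
  contribute. Nonempty faces of a cone contain the origin, so that their affine dimension is their
  linear dimension.
\<close>

definition conic_intrinsic_volume :: "nat \<Rightarrow> 'a::euclidean_space set \<Rightarrow> real" where
  "conic_intrinsic_volume k C =
     (\<Sum>F | F face_of C \<and> aff_dim F = int k.
        measure std_gaussian {x. closest_point C x \<in> rel_interior F})"

definition orthocentric_params :: "nat \<Rightarrow> (nat \<Rightarrow> real) \<Rightarrow> bool" where
  "orthocentric_params d lam \<longleftrightarrow>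
     (\<forall>i\<in>{0..d}. lam i > 0) \<or>
     ((\<exists>j\<in>{0..d}. lam j < 0 \<and> (\<forall>i\<in>{0..d}. i \<noteq> j \<longrightarrow> lam i > 0)) \<and> (\<Sum>i=0..d. lam i) < 0)"

definition inv_weight_matrix :: "real \<Rightarrow> ('i \<Rightarrow> real) \<Rightarrow> 'i \<Rightarrow> 'i \<Rightarrow> real" where
  "inv_weight_matrix l0 lam i j = 1 / l0 + (if i = j then 1 / lam i else 0)"

text \<open>
  The cone is only determined up to isometry, so being such a cone is a predicate; \<open>lam 0\<close> is the
  distinguished parameter.
\<close>

definition is_orthocentric_cone ::
    "nat \<Rightarrow> (nat \<Rightarrow> real) \<Rightarrow> (nat \<Rightarrow> real) \<Rightarrow> 'a::euclidean_space set \<Rightarrow> bool" where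
  "is_orthocentric_cone d lam eps C \<longleftrightarrow>
     (\<exists>v :: nat \<Rightarrow> 'a.
        inj_on v {1..d} \<and> independent (v ` {1..d}) \<and>
        (\<forall>i\<in>{1..d}. \<forall>j\<in>{1..d}. v i \<bullet> v j = inv_weight_matrix (lam 0) lam i j) \<and>
        C = convex_cone hull ((\<lambda>i. eps i *\<^sub>R v i) ` {1..d}))"

text \<open>
  A centered Gaussian vector \<open>(\<eta>\<^sub>i)\<close>, \<open>i \<in> I\<close>, is a linear image of a vector of independent standard
  normal variables. Taking as many of the latter as there are components is no loss of generality,
  since every positive semidefinite matrix has a square root of the same size. The covariance matrix
  determines the law, which justifies the definite description below.
\<close>

definition is_centered_gaussian ::
    "'i set \<Rightarrow> ('i \<Rightarrow> 'i \<Rightarrow> real) \<Rightarrow> ('i \<Rightarrow> real) measure \<Rightarrow> bool" where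
  "is_centered_gaussian I S M \<longleftrightarrow>
     (\<exists>A. M = distr (\<Pi>\<^sub>M j\<in>I. std_normal_distribution) (\<Pi>\<^sub>M i\<in>I. borel)
                (\<lambda>x. \<lambda>i\<in>I. \<Sum>j\<in>I. A i j * x j)) \<and>
     (\<forall>i\<in>I. \<forall>j\<in>I. (\<integral>x. x i * x j \<partial>M) = S i j)"

definition centered_gaussian :: "'i set \<Rightarrow> ('i \<Rightarrow> 'i \<Rightarrow> real) \<Rightarrow> ('i \<Rightarrow> real) measure" where
  "centered_gaussian I S = (THE M. is_centered_gaussian I S M)"

text \<open>
  \<open>g\<^sub>m(l0; lam\<^sub>1, \<dots>, lam\<^sub>m; eps\<^sub>1, \<dots>, eps\<^sub>m)\<close> is the case \<open>I = {1..m}\<close>. Parameters indexed by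
  an arbitrary finite set \<open>I\<close> allow subfamilies to be used without renumbering them.
\<close>

definition gfun :: "'i set \<Rightarrow> real \<Rightarrow> ('i \<Rightarrow> real) \<Rightarrow> ('i \<Rightarrow> real) \<Rightarrow> real" where
  "gfun I l0 lam eps =
     (if I = {} then 1
      else measure (centered_gaussian I (inv_weight_matrix l0 lam))
             {x \<in> space (\<Pi>\<^sub>M i\<in>I. borel). \<forall>i\<in>I. eps i * x i < 0})"

end

theory Submission
  imports Defs
begin

text \<open>
  The faces of the cone are spanned by the subfamilies \<open>v i\<close>, \<open>i \<in> I\<close>. Put
  \<open>s = lam 0 + (\<Sum>i\<in>I. lam i)\<close> and \<open>c = (\<Sum>i\<in>I. lam i *\<^sub>R v i) / s\<close>. The nearest point of the cone
  to \<open>x\<close> lies in the relative interior of the face of \<open>I\<close> iff \<open>eps i * lam i * ((v i - c) \<bullet> x) > 0\<close>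
  for \<open>i \<in> I\<close> and \<open>eps j * ((v j - c) \<bullet> x) \<le> 0\<close> for \<open>j \<notin> I\<close>. The vectors \<open>v i - c\<close> with \<open>i \<in> I\<close> are
  orthogonal to those with \<open>i \<notin> I\<close>, and the Gram matrices of the two families are again of the form
  \<open>1 / l0 + \<delta>\<^sub>i\<^sub>j / lam i\<close>, with \<open>l0 = - s\<close> and \<open>l0 = s\<close> respectively. So the probability of the event
  factorizes into two values of \<open>gfun\<close>. That Gaussian probabilities depend only on Gram matrices follows
  from a multivariate uniqueness theorem for characteristic functions, obtained from the
  one-dimensional one.
\<close>

section \<open>Characteristic functions determine probabilities of rectangles\<close>

text \<open>Levy's uniqueness theorem concerns probability distributions. The total mass is the
  value of \<open>char\<close> at 0, so both measures have the same mass and can be normalized by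
  the same constant; mass zero is treated apart because normalization is then impossible.\<close>

lemma finite_measure_eqI_char:
  fixes M N :: "real measure"
  assumes "finite_measure M" "finite_measure N"
    and sets [measurable_cong]: "sets M = sets borel" "sets N = sets borel"
    and char: "\<And>t. char M t = char N t"
  shows "M = N"
proof -
  interpret M: finite_measure M by fact
  interpret N: finite_measure N by fact
  have space: "space M = UNIV" "space N = UNIV"
    using sets_eq_imp_space_eq[OF sets(1)] sets_eq_imp_space_eq[OF sets(2)] by auto
  have mass: "measure M UNIV = measure N UNIV"
    using char[of 0] space by (simp add: char_def)
  show ?thesis
  proof (cases "measure M UNIV = 0")
    case True
    have "emeasure M A = emeasure N A" if "A \<in> sets M" for A
      using True mass M.bounded_measure[of A] N.bounded_measure[of A] space
      by (metis M.emeasure_eq_measure N.emeasure_eq_measure measure_le_0_iff)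
    then show ?thesis by (intro measure_eqI) (simp_all add: sets)
  next
    case False
    define c where "c = 1 / measure M UNIV"
    have c: "c > 0" using False by (simp add: c_def zero_less_measure_iff)
    have prob: "real_distribution (density P (\<lambda>_. ennreal c))"
      if "finite_measure P" "sets P = sets borel" "measure P UNIV = measure M UNIV" for P :: "real measure"
    proof -
      interpret P: finite_measure P by fact
      have sp: "space P = UNIV" using sets_eq_imp_space_eq[OF that(2)] by simp
      have "emeasure (density P (\<lambda>_. ennreal c)) (space P) = ennreal c * emeasure P (space P)"
        by (subst emeasure_density) (auto simp: nn_integral_cmult)
      also have "\<dots> = 1"
        using False that(3) c sp
        by (simp add: P.emeasure_eq_measure c_def ennreal_mult'[symmetric])
      finally show ?thesis
        by (auto simp: real_distribution_def real_distribution_axioms_def that sp intro!: prob_spaceI)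
    qed
    have ch: "char (density P (\<lambda>_. ennreal c)) t = c *\<^sub>R char P t"
      if [measurable_cong]: "sets P = sets borel" for P t
      unfolding char_def using c by (subst integral_density) auto
    have eq: "density M (\<lambda>_. ennreal c) = density N (\<lambda>_. ennreal c)"
      by (intro Levy_uniqueness prob ext) (simp_all add: ch sets char mass assms)
    have "emeasure M A = emeasure N A" if "A \<in> sets M" for A
    proof -
      have A: "A \<in> sets M" "A \<in> sets N" using that sets by auto
      have "ennreal c * emeasure M A = ennreal c * emeasure N A"
        using arg_cong[OF eq, of "\<lambda>P. emeasure P A"] A
        by (simp add: emeasure_density nn_integral_cmult)
      then show ?thesis using c
        by (simp add: ennreal_mult_cancel_left)
    qed
    then show ?thesis by (intro measure_eqI) (simp_all add: sets)
  qed
qed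

section \<open>Cosine weights and joint characteristic functions\<close>

lemma iexp_eq_cos_sin: "iexp x = complex_of_real (cos x) + \<i> * complex_of_real (sin x)"
  by (simp add: cis_conv_exp[symmetric] complex_eq_iff)

lemma integrable_iexp_comp:
  assumes "finite_measure M" and [measurable]: "f \<in> borel_measurable M"
  shows "integrable M (\<lambda>x. iexp (f x))"
proof -
  interpret finite_measure M by fact
  show ?thesis by (rule integrable_const_bound[of _ 1]) auto
qed

lemma finite_measure_density_bounded:
  fixes f :: "'a \<Rightarrow> real"
  assumes "finite_measure M" and [measurable]: "f \<in> borel_measurable M" and le: "\<And>x. f x \<le> c"
  shows "finite_measure (density M (\<lambda>x. ennreal (f x)))"
proof -
  interpret finite_measure M by fact
  have "emeasure (density M (\<lambda>x. ennreal (f x))) (space M)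
      = (\<integral>\<^sup>+x. ennreal (f x) * indicator (space M) x \<partial>M)"
    by (subst emeasure_density) auto
  also have "\<dots> \<le> (\<integral>\<^sup>+x. ennreal c \<partial>M)"
    by (rule nn_integral_mono) (auto simp: indicator_def intro: ennreal_leI le)
  also have "\<dots> < \<infinity>" by (simp add: ennreal_mult_less_top emeasure_eq_measure)
  finally show ?thesis by (intro finite_measureI) auto
qed

text \<open>
  Weighting by the complex exponential does not give a positive measure, but weighting by
  \<^term>\<open>1 + cos (\<theta> + a)\<close> does, and its characteristic function is a combination of three values of
  the joint one.
\<close>

definition cos_weighted :: "'a measure \<Rightarrow> ('a \<Rightarrow> real) \<Rightarrow> ('a \<Rightarrow> real) \<Rightarrow> real \<Rightarrow> real measure" where
  "cos_weighted P Z \<theta> a = distr (density P (\<lambda>x. ennreal (1 + cos (\<theta> x + a)))) borel Z"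

lemma one_plus_cos_nonneg: "0 \<le> 1 + cos (u :: real)"
  using cos_ge_minus_one[of u] by linarith

context
  fixes P :: "'a measure" and Z \<theta> :: "'a \<Rightarrow> real"
  assumes P: "finite_measure P"
    and meas [measurable]: "Z \<in> borel_measurable P" "\<theta> \<in> borel_measurable P"
begin

interpretation P: finite_measure P by (rule P)

lemma finite_measure_cos_weighted: "finite_measure (cos_weighted P Z \<theta> a)"
  unfolding cos_weighted_def
  by (intro finite_measure.finite_measure_distr finite_measure_density_bounded[where c = 2] P) auto

text \<open>Euler's formula splits the cosine into two exponentials. The factors 0, 1 and -1 of
  \<open>\<theta>\<close> stay explicit so that each integral is visibly a value of the joint
  characteristic function of \<open>Z\<close> and \<open>\<theta>\<close>.\<close>

lemma char_cos_weighted: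
  "char (cos_weighted P Z \<theta> a) s = (CLINT x|P. iexp (s * Z x + 0 * \<theta> x))
     + iexp a / 2 * (CLINT x|P. iexp (s * Z x + 1 * \<theta> x))
     + iexp (- a) / 2 * (CLINT x|P. iexp (s * Z x + (-1) * \<theta> x))"
proof -
  have lin: "(CLINT x|P. f x + c * g x + e * h x) = integral\<^sup>L P f + c * integral\<^sup>L P g + e * integral\<^sup>L P h"
    if "integrable P f" "integrable P g" "integrable P h" for f g h and c e :: complex
    using that by simp
  have "char (cos_weighted P Z \<theta> a) s = (CLINT x|P. (1 + cos (\<theta> x + a)) *\<^sub>R iexp (s * Z x))"
    unfolding cos_weighted_def char_def
    by (subst integral_distr, simp, simp, subst integral_density) (auto simp: one_plus_cos_nonneg)
  also have "\<dots> = (CLINT x|P. iexp (s * Z x + 0 * \<theta> x) + iexp a / 2 * iexp (s * Z x + 1 * \<theta> x)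
      + iexp (- a) / 2 * iexp (s * Z x + (-1) * \<theta> x))"
  proof (intro Bochner_Integration.integral_cong refl)
    fix x
    have "complex_of_real (cos (\<theta> x + a)) = (iexp (\<theta> x + a) + iexp (- (\<theta> x + a))) / 2"
      unfolding iexp_eq_cos_sin[of "\<theta> x + a"] iexp_eq_cos_sin[of "- (\<theta> x + a)"] cos_minus sin_minus
      by simp
    then show "(1 + cos (\<theta> x + a)) *\<^sub>R iexp (s * Z x) = iexp (s * Z x + 0 * \<theta> x)
        + iexp a / 2 * iexp (s * Z x + 1 * \<theta> x) + iexp (- a) / 2 * iexp (s * Z x + (-1) * \<theta> x)"
      by (simp add: scaleR_conv_of_real exp_add[symmetric] algebra_simps add_divide_distrib)
  qed
  also have "\<dots> = (CLINT x|P. iexp (s * Z x + 0 * \<theta> x))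
      + iexp a / 2 * (CLINT x|P. iexp (s * Z x + 1 * \<theta> x))
      + iexp (- a) / 2 * (CLINT x|P. iexp (s * Z x + (-1) * \<theta> x))"
    by (rule lin; rule integrable_iexp_comp[OF P]; measurable)
  finally show ?thesis .
qed

lemma measure_cos_weighted:
  assumes [measurable]: "B \<in> sets borel"
  shows "measure (cos_weighted P Z \<theta> a) B =
    (LINT x|P. indicator B (Z x)) + (LINT x|P. cos (\<theta> x + a) * indicator B (Z x))"
proof -
  have "measure (cos_weighted P Z \<theta> a) B = (LINT x|cos_weighted P Z \<theta> a. indicator B x)"
    by (simp add: cos_weighted_def)
  also have "\<dots> = (LINT x|P. (1 + cos (\<theta> x + a)) *\<^sub>R indicator B (Z x))"
    unfolding cos_weighted_def
    by (subst integral_distr, simp, simp, subst integral_density) (auto simp: one_plus_cos_nonneg)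
  also have "\<dots> = (LINT x|P. indicator B (Z x) + cos (\<theta> x + a) * indicator B (Z x))"
    by (simp add: algebra_simps)
  also have "\<dots> = (LINT x|P. indicator B (Z x)) + (LINT x|P. cos (\<theta> x + a) * indicator B (Z x))"
    by (intro Bochner_Integration.integral_add P.integrable_const_bound[of _ 1])
       (auto simp: indicator_def abs_mult)
  finally show ?thesis .
qed

lemma integral_indicator_iexp:
  assumes [measurable]: "B \<in> sets borel"
  shows "(CLINT x|P. indicator B (Z x) *\<^sub>R iexp (\<theta> x))
    = complex_of_real (LINT x|P. cos (\<theta> x) * indicator B (Z x))
      + \<i> * complex_of_real (LINT x|P. sin (\<theta> x) * indicator B (Z x))"
proof -
  have "(CLINT x|P. indicator B (Z x) *\<^sub>R iexp (\<theta> x))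
      = (CLINT x|P. complex_of_real (cos (\<theta> x) * indicator B (Z x)) +
           \<i> * complex_of_real (sin (\<theta> x) * indicator B (Z x)))"
    by (intro Bochner_Integration.integral_cong refl) (simp add: iexp_eq_cos_sin indicator_def)
  also have "\<dots> = (CLINT x|P. complex_of_real (cos (\<theta> x) * indicator B (Z x))) +
      (CLINT x|P. \<i> * complex_of_real (sin (\<theta> x) * indicator B (Z x)))"
    by (intro Bochner_Integration.integral_add integrable_mult_right integrable_of_real
        P.integrable_const_bound[of _ 1])
       (auto simp: indicator_def)
  finally show ?thesis by (simp del: of_real_mult)
qed

end

text \<open>One-dimensional uniqueness identifies the cosine-weighted laws of \<open>Z\<close> and
  \<open>Z'\<close> for every frequency \<open>r\<close> and phase \<open>a\<close>. Suitable
  choices of \<open>r\<close> and \<open>a\<close> recover the constant, cosine and sine weights,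
  hence the complex exponential weight.\<close>

lemma integral_indicator_iexp_eqI:
  fixes Z \<theta> :: "'a \<Rightarrow> real" and Z' \<theta>' :: "'b \<Rightarrow> real"
  assumes M: "finite_measure M" and N: "finite_measure N"
    and meas [measurable]: "Z \<in> borel_measurable M" "\<theta> \<in> borel_measurable M"
      "Z' \<in> borel_measurable N" "\<theta>' \<in> borel_measurable N"
    and eq: "\<And>s r. (CLINT x|M. iexp (s * Z x + r * \<theta> x)) = (CLINT y|N. iexp (s * Z' y + r * \<theta>' y))"
    and B [measurable]: "B \<in> sets borel"
  shows "(CLINT x|M. indicator B (Z x) *\<^sub>R iexp (\<theta> x)) = (CLINT y|N. indicator B (Z' y) *\<^sub>R iexp (\<theta>' y))"
proof -
  have W_eq: "cos_weighted M Z (\<lambda>x. r * \<theta> x) a = cos_weighted N Z' (\<lambda>x. r * \<theta>' x) a" for a r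
  proof (rule finite_measure_eqI_char)
    show "char (cos_weighted M Z (\<lambda>x. r * \<theta> x) a) t = char (cos_weighted N Z' (\<lambda>x. r * \<theta>' x) a) t" for t
      using eq[of t 0] eq[of t r] eq[of t "- r"]
      by (simp add: char_cos_weighted M N del: of_real_add of_real_mult)
  qed (intro finite_measure_cos_weighted M N; measurable; fail | simp add: cos_weighted_def)+
  have W_meas: "(LINT x|M. indicator B (Z x)) + (LINT x|M. cos (r * \<theta> x + a) * indicator B (Z x))
      = (LINT x|N. indicator B (Z' x)) + (LINT x|N. cos (r * \<theta>' x + a) * indicator B (Z' x))" for r a
    using arg_cong[OF W_eq, of "\<lambda>P. measure P B" r a] by (simp add: measure_cos_weighted M N)
  \<comment> \<open>For \<open>r = 0\<close> and \<open>a = 0\<close> the weight is the constant 2.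
    This gives the unweighted term, which is cancelled in the next two steps.\<close>
  have B_eq: "(LINT x|M. indicator B (Z x) :: real) = (LINT x|N. indicator B (Z' x))"
    using W_meas[of 0 0] by simp
  have "(LINT x|M. cos (\<theta> x) * indicator B (Z x)) = (LINT x|N. cos (\<theta>' x) * indicator B (Z' x))"
    using W_meas[of 1 0] B_eq by simp
  \<comment> \<open>The phase \<open>- (pi / 2)\<close> turns the cosine into a sine.\<close>
  moreover have "(LINT x|M. sin (\<theta> x) * indicator B (Z x)) = (LINT x|N. sin (\<theta>' x) * indicator B (Z' x))"
    using W_meas[of 1 "- (pi / 2)"] B_eq by (simp add: cos_diff)
  ultimately show ?thesis by (simp add: integral_indicator_iexp M N)
qed

text \<open>
  Fixing the events coordinate by coordinate replaces each measure by its restriction to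
  \<^term>\<open>Z -` B\<close>, whose characteristic function in the remaining coordinates is still determined.
\<close>

definition preimage_weighted :: "'a measure \<Rightarrow> ('a \<Rightarrow> real) \<Rightarrow> real set \<Rightarrow> 'a measure" where
  "preimage_weighted P Z B = density P (\<lambda>x. ennreal (indicator B (Z x)))"

lemma finite_measure_preimage_weighted:
  assumes "finite_measure P" "Z \<in> borel_measurable P" "B \<in> sets borel"
  shows "finite_measure (preimage_weighted P Z B)"
  unfolding preimage_weighted_def using assms
  by (intro finite_measure_density_bounded[where c = 1]) auto

lemma measure_preimage_weighted:
  assumes [measurable]: "Z \<in> borel_measurable P" "B \<in> sets borel" "Measurable.pred P Q"
  shows "measure (preimage_weighted P Z B) {x \<in> space P. Q x} = measure P {x \<in> space P. Z x \<in> B \<and> Q x}"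
proof -
  have "emeasure (preimage_weighted P Z B) {x \<in> space P. Q x} =
      (\<integral>\<^sup>+x. indicator {x \<in> space P. Z x \<in> B \<and> Q x} x \<partial>P)"
    unfolding preimage_weighted_def
    by (subst emeasure_density; (measurable; fail)?) (rule nn_integral_cong, auto simp: indicator_def)
  also have "\<dots> = emeasure P {x \<in> space P. Z x \<in> B \<and> Q x}"
    by (rule nn_integral_indicator) measurable
  finally show ?thesis by (simp add: measure_def)
qed

lemma integral_preimage_weighted:
  assumes "Z \<in> borel_measurable P" "B \<in> sets borel" "\<theta> \<in> borel_measurable P"
  shows "(CLINT x|preimage_weighted P Z B. iexp (\<theta> x)) = (CLINT x|P. indicator B (Z x) *\<^sub>R iexp (\<theta> x))"
  unfolding preimage_weighted_def using assms by (subst integral_density) auto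

text \<open>Induction on the index set with both measures generalized: each step absorbs one event
  into the measures, after which they are in general only finite and no longer of mass 1. For the
  empty index set the hypothesis on the integrals compares the total masses.\<close>

lemma measure_rectangle_eqI_char:
  fixes X :: "'k \<Rightarrow> 'a \<Rightarrow> real" and Y :: "'k \<Rightarrow> 'b \<Rightarrow> real"
  assumes "finite K" "finite_measure M" "finite_measure N"
    and "\<And>k. k \<in> K \<Longrightarrow> X k \<in> borel_measurable M" "\<And>k. k \<in> K \<Longrightarrow> Y k \<in> borel_measurable N"
    and "\<And>t. (CLINT x|M. iexp (\<Sum>k\<in>K. t k * X k x)) = (CLINT y|N. iexp (\<Sum>k\<in>K. t k * Y k y))"
    and "\<And>k. k \<in> K \<Longrightarrow> B k \<in> sets borel"
  shows "measure M {x \<in> space M. \<forall>k\<in>K. X k x \<in> B k} = measure N {y \<in> space N. \<forall>k\<in>K. Y k y \<in> B k}"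
  using assms
proof (induction K arbitrary: M N rule: finite_induct)
  case empty
  then show ?case by simp
next
  case (insert k K)
  have meas [measurable]: "X k \<in> borel_measurable M" "Y k \<in> borel_measurable N"
    "\<And>j. j \<in> K \<Longrightarrow> X j \<in> borel_measurable M" "\<And>j. j \<in> K \<Longrightarrow> Y j \<in> borel_measurable N"
    "B k \<in> sets borel" "\<And>j. j \<in> K \<Longrightarrow> B j \<in> sets borel"
    using insert.prems by auto
  let ?M = "preimage_weighted M (X k) (B k)" and ?N = "preimage_weighted N (Y k) (B k)"
  have sum_meas [measurable]: "(\<lambda>x. \<Sum>j\<in>K. t j * X j x) \<in> borel_measurable M"
    "(\<lambda>x. \<Sum>j\<in>K. t j * Y j x) \<in> borel_measurable N" for t
    by measurable
  have "(CLINT x|?M. iexp (\<Sum>j\<in>K. t j * X j x)) = (CLINT x|?N. iexp (\<Sum>j\<in>K. t j * Y j x))" for t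
  proof -
    have "(CLINT x|M. iexp (s * X k x + r * (\<Sum>j\<in>K. t j * X j x))) =
        (CLINT x|N. iexp (s * Y k x + r * (\<Sum>j\<in>K. t j * Y j x)))" for s r
    proof -
      \<comment> \<open>The frequencies \<open>s\<close> at \<open>k\<close> and
        \<open>r * t j\<close> elsewhere turn the two-variable integrand into a single linear form
        in all coordinates, to which the hypothesis applies.\<close>
      have *: "(\<Sum>j\<in>insert k K. ((\<lambda>j. r * t j)(k := s)) j * Z j) = s * Z k + r * (\<Sum>j\<in>K. t j * Z j)" for Z
      proof -
        have "(\<Sum>j\<in>K. (if j = k then s else r * t j) * Z j) = (\<Sum>j\<in>K. r * t j * Z j)"
          using \<open>k \<notin> K\<close> by (intro sum.cong) auto
        then show ?thesis
          using \<open>k \<notin> K\<close> \<open>finite K\<close> by (simp add: sum_distrib_left mult.assoc)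
      qed
      show ?thesis using insert.prems(5)[of "(\<lambda>j. r * t j)(k := s)"] unfolding * .
    qed
    then have "(CLINT x|M. indicator (B k) (X k x) *\<^sub>R iexp (\<Sum>j\<in>K. t j * X j x)) =
        (CLINT x|N. indicator (B k) (Y k x) *\<^sub>R iexp (\<Sum>j\<in>K. t j * Y j x))"
      by (intro integral_indicator_iexp_eqI insert.prems(1,2) sum_meas meas(1,2,5))
    then show ?thesis
      by (simp only: integral_preimage_weighted meas(1,2,5) sum_meas)
  qed
  moreover have "X j \<in> borel_measurable ?M" "Y j \<in> borel_measurable ?N" if "j \<in> K" for j
    using that by (auto simp: preimage_weighted_def)
  ultimately have "measure ?M {x \<in> space ?M. \<forall>j\<in>K. X j x \<in> B j} = measure ?N {x \<in> space ?N. \<forall>j\<in>K. Y j x \<in> B j}"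
    by (intro insert.IH finite_measure_preimage_weighted insert.prems(1,2) meas)
  moreover have "space ?M = space M" "space ?N = space N"
    by (simp_all add: preimage_weighted_def)
  moreover have "Measurable.pred M (\<lambda>x. \<forall>j\<in>K. X j x \<in> B j)" "Measurable.pred N (\<lambda>x. \<forall>j\<in>K. Y j x \<in> B j)"
    using \<open>finite K\<close> by measurable
  ultimately show ?case
    by (simp add: measure_preimage_weighted)
qed

section \<open>Centered Gaussian vectors\<close>

interpretation std_normal: prob_space std_normal_distribution
  by (rule prob_space_normal_density) simp

interpretation std_normal_PiM: product_prob_space "\<lambda>_::'k. std_normal_distribution" I for I
  by unfold_locales

lemma integral_iexp_PiM_std_normal:
  assumes "finite J"
  shows "(CLINT x|(\<Pi>\<^sub>M j\<in>J. std_normal_distribution). iexp (\<Sum>j\<in>J. a j * x j))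
    = complex_of_real (exp (- (\<Sum>j\<in>J. (a j)\<^sup>2) / 2))"
proof -
  have "(CLINT x|(\<Pi>\<^sub>M j\<in>J. std_normal_distribution). iexp (\<Sum>j\<in>J. a j * x j))
      = (CLINT x|(\<Pi>\<^sub>M j\<in>J. std_normal_distribution). (\<Prod>j\<in>J. iexp (a j * x j)))"
    using assms by (simp add: exp_sum sum_distrib_left)
  also have "\<dots> = (\<Prod>j\<in>J. CLINT x|std_normal_distribution. iexp (a j * x))"
    using assms
    by (intro std_normal_PiM.product_integral_prod integrable_iexp_comp
        std_normal.finite_measure_axioms) auto
  also have "\<dots> = (\<Prod>j\<in>J. complex_of_real (exp (- ((a j)\<^sup>2) / 2)))"
    unfolding char_def[symmetric] char_std_normal_distribution ..
  also have "\<dots> = complex_of_real (exp (- (\<Sum>j\<in>J. (a j)\<^sup>2) / 2))"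
    using assms by (simp add: exp_sum[symmetric] sum_negf sum_divide_distrib flip: of_real_prod)
  finally show ?thesis .
qed

lemma std_normal_moments:
  "integrable std_normal_distribution (\<lambda>x. x)" "(LINT x|std_normal_distribution. x) = 0"
  "integrable std_normal_distribution (\<lambda>x. x * x)" "(LINT x|std_normal_distribution. x * x) = 1"
  using integrable_std_normal_moment[of 1] integrable_std_normal_moment[of 2]
    integral_std_normal_moment_odd[of 0] integral_std_normal_moment_even[of 1]
  by (simp_all add: integrable_density integral_density power2_eq_square)

lemma integral_mult_PiM_std_normal:
  assumes "finite J" "k \<in> J" "l \<in> J"
  shows "integrable (\<Pi>\<^sub>M j\<in>J. std_normal_distribution) (\<lambda>x. x k * x l)"
    and "(LINT x|(\<Pi>\<^sub>M j\<in>J. std_normal_distribution). x k * x l) = (if k = l then 1 else 0)"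
proof -
  \<comment> \<open>Filling up with factors 1 makes \<open>x k * x l\<close> a product of
    one-variable functions over all of \<open>J\<close>; for \<open>k = l\<close> the factor at
    \<open>k\<close> is a square.\<close>
  define f where "f j x = (if j = k then x else 1) * (if j = l then x else 1)" for j and x :: real
  have prod: "(\<Prod>j\<in>J. f j (x j)) = x k * x l" for x
    using assms by (simp add: f_def prod.distrib prod.delta)
  have int: "integrable std_normal_distribution (f j)" for j
    using std_normal_moments by (cases "j = k"; cases "j = l") (simp_all add: f_def[abs_def])
  \<comment> \<open>The condition fails exactly when \<open>j\<close> is one of two distinct indices
    \<open>k\<close>, \<open>l\<close>; the factor is then the mean 0. Otherwise it is the second
    moment or the total mass, both 1.\<close>
  have integral: "integral\<^sup>L std_normal_distribution (f j) = (if (j = k) = (j = l) then 1 else 0)" for j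
    using std_normal_moments std_normal.prob_space
    by (cases "j = k"; cases "j = l") (simp_all add: f_def[abs_def])
  show "integrable (\<Pi>\<^sub>M j\<in>J. std_normal_distribution) (\<lambda>x. x k * x l)"
    using std_normal_PiM.product_integrable_prod[OF assms(1), of f] int by (simp add: prod)
  have "(LINT x|(\<Pi>\<^sub>M j\<in>J. std_normal_distribution). x k * x l)
      = (\<Prod>j\<in>J. if (j = k) = (j = l) then 1 else 0)"
    using std_normal_PiM.product_integral_prod[OF assms(1), of f] int by (simp add: prod integral)
  also have "\<dots> = (if k = l then 1 else 0)"
  proof (cases "k = l")
    case False
    then show ?thesis using assms by (auto intro!: prod_zero bexI[of _ k])
  qed simp
  finally show "(LINT x|(\<Pi>\<^sub>M j\<in>J. std_normal_distribution). x k * x l) = (if k = l then 1 else 0)" .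
qed

section \<open>The standard Gaussian measure on a Euclidean space\<close>

lemma std_gaussian_map_measurable:
  "(\<lambda>x. \<Sum>b\<in>Basis. x b *\<^sub>R b) \<in> (\<Pi>\<^sub>M b\<in>Basis. std_normal_distribution) \<rightarrow>\<^sub>M borel"
  by measurable

lemma sets_std_gaussian [measurable_cong, simp]: "sets std_gaussian = sets borel"
  and space_std_gaussian [simp]: "space std_gaussian = UNIV"
  by (simp_all add: std_gaussian_def)

lemma prob_space_std_gaussian: "prob_space (std_gaussian :: 'a::euclidean_space measure)"
  unfolding std_gaussian_def
  by (intro prob_space.prob_space_distr prob_space_PiM std_normal.prob_space_axioms
      std_gaussian_map_measurable)

lemma integral_iexp_std_gaussian:
  fixes u :: "'a::euclidean_space"
  shows "(CLINT x|std_gaussian. iexp (u \<bullet> x)) = complex_of_real (exp (- (u \<bullet> u) / 2))"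
proof -
  have "(CLINT x|std_gaussian. iexp (u \<bullet> x)) =
      (CLINT x|(\<Pi>\<^sub>M b\<in>Basis. std_normal_distribution). iexp (u \<bullet> (\<Sum>b\<in>Basis. x b *\<^sub>R b)))"
    unfolding std_gaussian_def by (rule integral_distr[OF std_gaussian_map_measurable]) measurable
  also have "\<dots> = (CLINT x|(\<Pi>\<^sub>M b\<in>Basis. std_normal_distribution). iexp (\<Sum>b\<in>Basis. (u \<bullet> b) * x b))"
    by (simp add: inner_sum_right mult.commute)
  also have "\<dots> = complex_of_real (exp (- (u \<bullet> u) / 2))"
    by (subst integral_iexp_PiM_std_normal) (simp_all add: euclidean_inner[of u u] power2_eq_square)
  finally show ?thesis .
qed

lemma inner_sum_sum:
  fixes u :: "'k \<Rightarrow> 'a::real_inner"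
  shows "(\<Sum>k\<in>K. t k *\<^sub>R u k) \<bullet> (\<Sum>k\<in>K. t k *\<^sub>R u k) = (\<Sum>k\<in>K. \<Sum>l\<in>K. t k * t l * (u k \<bullet> u l))"
  unfolding inner_sum_left unfolding inner_sum_right by (simp add: mult_ac)

lemma integral_iexp_std_gaussian_family:
  fixes u :: "'k \<Rightarrow> 'a::euclidean_space"
  shows "(CLINT x|std_gaussian. iexp (\<Sum>k\<in>K. t k * (u k \<bullet> x)))
    = complex_of_real (exp (- (\<Sum>k\<in>K. \<Sum>l\<in>K. t k * t l * (u k \<bullet> u l)) / 2))"
  using integral_iexp_std_gaussian[of "\<Sum>k\<in>K. t k *\<^sub>R u k"]
  by (simp add: inner_sum_left flip: inner_sum_sum)

section \<open>Laws with a prescribed covariance matrix\<close>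

lemma linear_image_measurable:
  "(\<lambda>x. \<lambda>i\<in>I. \<Sum>j\<in>J. A i j * x j) \<in>
     (\<Pi>\<^sub>M j\<in>J. std_normal_distribution) \<rightarrow>\<^sub>M (\<Pi>\<^sub>M i\<in>I. (borel :: real measure))"
  by measurable

lemma integral_mult_linear_image:
  assumes "finite J" "k \<in> I" "l \<in> I"
  shows "(LINT x|distr (\<Pi>\<^sub>M j\<in>J. std_normal_distribution) (\<Pi>\<^sub>M i\<in>I. borel)
       (\<lambda>x. \<lambda>i\<in>I. \<Sum>j\<in>J. A i j * x j). x k * x l) = (\<Sum>j\<in>J. A k j * A l j)"
proof -
  have meas: "(\<lambda>x. x k * x l) \<in> borel_measurable (\<Pi>\<^sub>M i\<in>I. (borel :: real measure))"
    using assms by (intro borel_measurable_times measurable_component_singleton)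
  have "(LINT x|distr (\<Pi>\<^sub>M j\<in>J. std_normal_distribution) (\<Pi>\<^sub>M i\<in>I. borel)
       (\<lambda>x. \<lambda>i\<in>I. \<Sum>j\<in>J. A i j * x j). x k * x l) =
     (LINT x|(\<Pi>\<^sub>M j\<in>J. std_normal_distribution). (\<Sum>i\<in>J. A k i * x i) * (\<Sum>j\<in>J. A l j * x j))"
    using assms by (simp add: integral_distr[OF linear_image_measurable meas])
  also have "\<dots> = (LINT x|(\<Pi>\<^sub>M j\<in>J. std_normal_distribution). (\<Sum>i\<in>J. \<Sum>j\<in>J. (A k i * A l j) * (x i * x j)))"
    by (simp add: sum_product mult_ac)
  also have "\<dots> = (\<Sum>i\<in>J. \<Sum>j\<in>J. (A k i * A l j) * (if i = j then 1 else 0))"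
    using integral_mult_PiM_std_normal[OF assms(1)]
    by (simp add: Bochner_Integration.integral_sum cong: sum.cong)
  also have "\<dots> = (\<Sum>j\<in>J. A k j * A l j)"
    using assms(1) by (simp add: if_distrib[of "(*) _"] cong: if_cong)
  finally show ?thesis .
qed

text \<open>Evaluated at \<open>t\<close>, the characteristic function is that of independent
  normals with the coefficients of \<open>t\<close> times \<open>A\<close>. Its exponent is the
  quadratic form of \<open>A\<close> times its transpose, which the covariance condition identifies
  with \<open>S\<close>; so \<open>A\<close> drops out.\<close>

lemma is_centered_gaussianD:
  assumes "finite K" "is_centered_gaussian K S M"
  shows "prob_space M" "sets M = sets (\<Pi>\<^sub>M k\<in>K. borel)"
    and "(CLINT x|M. iexp (\<Sum>k\<in>K. t k * x k)) =
      complex_of_real (exp (- (\<Sum>k\<in>K. \<Sum>l\<in>K. t k * t l * S k l) / 2))"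
proof -
  obtain A where M: "M = distr (\<Pi>\<^sub>M j\<in>K. std_normal_distribution) (\<Pi>\<^sub>M i\<in>K. borel)
      (\<lambda>x. \<lambda>i\<in>K. \<Sum>j\<in>K. A i j * x j)"
    and S: "\<And>i j. i \<in> K \<Longrightarrow> j \<in> K \<Longrightarrow> (\<integral>x. x i * x j \<partial>M) = S i j"
    using assms(2) unfolding is_centered_gaussian_def by blast
  have S_eq: "S i j = (\<Sum>l\<in>K. A i l * A j l)" if "i \<in> K" "j \<in> K" for i j
    using S[OF that] integral_mult_linear_image[OF assms(1) that] by (simp add: M)
  show "prob_space M"
    unfolding M
    by (intro prob_space.prob_space_distr prob_space_PiM std_normal.prob_space_axioms linear_image_measurable)
  show "sets M = sets (\<Pi>\<^sub>M k\<in>K. borel)" by (simp add: M)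
  have [measurable]: "(\<lambda>x. \<Sum>k\<in>K. t k * x k) \<in> borel_measurable (\<Pi>\<^sub>M k\<in>K. (borel :: real measure))"
    by (intro borel_measurable_sum borel_measurable_times borel_measurable_const measurable_component_singleton)
  have meas: "(\<lambda>x. iexp (\<Sum>k\<in>K. t k * x k)) \<in> borel_measurable (\<Pi>\<^sub>M k\<in>K. (borel :: real measure))"
    by measurable
  have "(CLINT x|M. iexp (\<Sum>k\<in>K. t k * x k)) =
      (CLINT x|(\<Pi>\<^sub>M j\<in>K. std_normal_distribution). iexp (\<Sum>k\<in>K. t k * (\<Sum>j\<in>K. A k j * x j)))"
    unfolding M integral_distr[OF linear_image_measurable meas]
    by (simp cong: sum.cong del: of_real_sum of_real_mult)
  also have "\<dots> = (CLINT x|(\<Pi>\<^sub>M j\<in>K. std_normal_distribution). iexp (\<Sum>j\<in>K. (\<Sum>k\<in>K. t k * A k j) * x j))"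
    unfolding sum_distrib_left sum_distrib_right mult.assoc by (subst sum.swap) (rule refl)
  also have "\<dots> = complex_of_real (exp (- (\<Sum>j\<in>K. (\<Sum>k\<in>K. t k * A k j)\<^sup>2) / 2))"
    by (rule integral_iexp_PiM_std_normal[OF assms(1)])
  also have "(\<Sum>j\<in>K. (\<Sum>k\<in>K. t k * A k j)\<^sup>2) = (\<Sum>j\<in>K. \<Sum>k\<in>K. \<Sum>l\<in>K. t k * t l * (A k j * A l j))"
    by (simp add: power2_eq_square sum_product mult_ac)
  also have "\<dots> = (\<Sum>k\<in>K. \<Sum>l\<in>K. \<Sum>j\<in>K. t k * t l * (A k j * A l j))"
    by (rule trans[OF sum.swap], rule sum.cong[OF refl], rule sum.swap)
  also have "\<dots> = (\<Sum>k\<in>K. \<Sum>l\<in>K. t k * t l * S k l)"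
    by (simp add: S_eq sum_distrib_left cong: sum.cong)
  finally show "(CLINT x|M. iexp (\<Sum>k\<in>K. t k * x k)) =
      complex_of_real (exp (- (\<Sum>k\<in>K. \<Sum>l\<in>K. t k * t l * S k l) / 2))" .
qed

text \<open>The uniqueness half of the definite description \<open>centered_gaussian\<close>. Both
  laws have the same characteristic function, hence agree on measurable rectangles, and these
  generate the product sigma-algebra.\<close>

lemma is_centered_gaussian_unique:
  assumes "finite K" "is_centered_gaussian K S M" "is_centered_gaussian K S N"
  shows "M = N"
proof -
  interpret M: prob_space M by (rule is_centered_gaussianD[OF assms(1,2)])
  interpret N: prob_space N by (rule is_centered_gaussianD[OF assms(1,3)])
  note sets [measurable_cong] = is_centered_gaussianD(2)[OF assms(1,2)] is_centered_gaussianD(2)[OF assms(1,3)]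
  note space = sets_eq_imp_space_eq[OF sets(1)] sets_eq_imp_space_eq[OF sets(2)]
  show ?thesis
  proof (rule measure_eqI_PiM_finite[OF assms(1) sets])
    fix A :: "'a \<Rightarrow> real set"
    assume A: "\<And>i. i \<in> K \<Longrightarrow> A i \<in> sets borel"
    have "measure M {x \<in> space M. \<forall>k\<in>K. x k \<in> A k} = measure N {x \<in> space N. \<forall>k\<in>K. x k \<in> A k}"
    proof (rule measure_rectangle_eqI_char[OF assms(1) M.finite_measure_axioms N.finite_measure_axioms])
      show "(CLINT x|M. iexp (\<Sum>k\<in>K. t k * x k)) = (CLINT x|N. iexp (\<Sum>k\<in>K. t k * x k))" for t
        by (simp only: is_centered_gaussianD(3)[OF assms(1,2)] is_centered_gaussianD(3)[OF assms(1,3)])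
    qed (use A in auto)
    moreover have "Pi\<^sub>E K A = {x \<in> space M. \<forall>k\<in>K. x k \<in> A k}" "Pi\<^sub>E K A = {x \<in> space N. \<forall>k\<in>K. x k \<in> A k}"
      unfolding space by (auto simp: space_PiM PiE_iff intro: extensional_arb)
    ultimately show "emeasure M (Pi\<^sub>E K A) = emeasure N (Pi\<^sub>E K A)"
      by (simp add: M.emeasure_eq_measure N.emeasure_eq_measure)
  next
    show "range (\<lambda>_::nat. \<Pi>\<^sub>E i\<in>K. UNIV) \<subseteq> prod_algebra K (\<lambda>_. borel :: real measure)"
      using assms(1) by (auto intro!: prod_algebraI_finite)
  qed (simp_all add: space_PiM)
qed

text \<open>The definition of a Gaussian vector asks for exactly as many normals as components,
  whatever the dimension of the space containing the \<open>u k\<close>. An orthonormal basis of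
  their span has at most \<open>card K\<close> elements, so its coordinates can be labelled by
  \<open>K\<close>.\<close>

lemma gram_factorization:
  fixes u :: "'k \<Rightarrow> 'a::euclidean_space"
  assumes "finite K"
  obtains A :: "'k \<Rightarrow> 'k \<Rightarrow> real" where "\<And>k l. k \<in> K \<Longrightarrow> l \<in> K \<Longrightarrow> (\<Sum>j\<in>K. A k j * A l j) = u k \<bullet> u l"
proof -
  obtain B where B: "B \<subseteq> span (u ` K)" "pairwise orthogonal B" "\<And>x. x \<in> B \<Longrightarrow> norm x = 1"
    "independent B" "card B = dim (span (u ` K))" "span B = span (u ` K)"
    using orthonormal_basis_subspace[of "span (u ` K)"] by auto
  have "finite B" using B(4) by (rule independent_imp_finite)
  have "card B \<le> card K"
    using B(5) dim_le_card'[of "u ` K"] card_image_le[OF assms, of u] assms by (simp add: dim_span)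
  then obtain f where f: "f ` B \<subseteq> K" "inj_on f B"
    using card_le_inj[OF \<open>finite B\<close> assms] by auto
  \<comment> \<open>Columns whose index labels no basis vector are zero and do not affect the inner
    products.\<close>
  define A where "A k j = (if j \<in> f ` B then u k \<bullet> inv_into B f j else 0)" for k j
  have "(\<Sum>j\<in>K. A k j * A l j) = u k \<bullet> u l" if "k \<in> K" "l \<in> K" for k l
  proof -
    have "(\<Sum>j\<in>K. A k j * A l j) = (\<Sum>j\<in>f ` B. A k j * A l j)"
      using f assms by (intro sum.mono_neutral_right) (auto simp: A_def)
    also have "\<dots> = (\<Sum>b\<in>B. (u k \<bullet> b) * (u l \<bullet> b))"
      using f by (subst sum.reindex) (auto intro!: sum.cong simp: A_def)
    also have "\<dots> = u k \<bullet> (\<Sum>b\<in>B. (u l \<bullet> b) *\<^sub>R b)"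
      by (simp add: inner_sum_right mult.commute)
    also have "(\<Sum>b\<in>B. (u l \<bullet> b) *\<^sub>R b) = u l"
      using orthonormal_basis_expand[OF B(2,3) _ \<open>finite B\<close>, of "u l"] that B(6)
      by (auto simp: span_base)
    finally show ?thesis .
  qed
  then show thesis by (rule that)
qed

text \<open>The existence half of the definite description: realizing \<open>S\<close> as a Gram
  matrix provides the required factor of \<open>S\<close>.\<close>

lemma is_centered_gaussian_centered_gaussian:
  fixes u :: "'k \<Rightarrow> 'a::euclidean_space"
  assumes "finite K" and "\<And>k l. k \<in> K \<Longrightarrow> l \<in> K \<Longrightarrow> u k \<bullet> u l = S k l"
  shows "is_centered_gaussian K S (centered_gaussian K S)"
proof -
  obtain A :: "'k \<Rightarrow> 'k \<Rightarrow> real" where A: "\<And>k l. k \<in> K \<Longrightarrow> l \<in> K \<Longrightarrow> (\<Sum>j\<in>K. A k j * A l j) = u k \<bullet> u l"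
    using gram_factorization[OF assms(1)] by blast
  have "is_centered_gaussian K S (distr (\<Pi>\<^sub>M j\<in>K. std_normal_distribution) (\<Pi>\<^sub>M i\<in>K. borel)
      (\<lambda>x. \<lambda>i\<in>K. \<Sum>j\<in>K. A i j * x j))"
    unfolding is_centered_gaussian_def
    using integral_mult_linear_image[OF assms(1), of _ K _ A] A assms(2) by auto
  then have "\<exists>!M. is_centered_gaussian K S M"
    using is_centered_gaussian_unique[OF assms(1)] by blast
  then show ?thesis unfolding centered_gaussian_def by (rule theI')
qed

text \<open>The variables \<open>u k \<bullet> x\<close> have the Gram matrix of \<open>u\<close> as
  covariance. Since the ambient space is arbitrary, several values of \<open>gfun\<close> can be
  read off from subfamilies of vectors in one space.\<close>

lemma gfun_eq_measure_std_gaussian: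
  fixes u :: "'k \<Rightarrow> 'a::euclidean_space"
  assumes "finite K" and u: "\<And>k l. k \<in> K \<Longrightarrow> l \<in> K \<Longrightarrow> u k \<bullet> u l = inv_weight_matrix l0 lam k l"
  shows "gfun K l0 lam eps = measure std_gaussian {x :: 'a. \<forall>k\<in>K. eps k * (u k \<bullet> x) < 0}"
proof (cases "K = {}")
  case True
  interpret prob_space "std_gaussian :: 'a measure" by (rule prob_space_std_gaussian)
  show ?thesis using True prob_space by (simp add: gfun_def)
next
  case False
  define S where "S = inv_weight_matrix l0 lam"
  define M where "M = centered_gaussian K S"
  have M: "is_centered_gaussian K S M"
    unfolding M_def using assms by (intro is_centered_gaussian_centered_gaussian[of K u]) (auto simp: S_def)
  interpret M: prob_space M by (rule is_centered_gaussianD[OF assms(1) M])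
  interpret G: prob_space "std_gaussian :: 'a measure" by (rule prob_space_std_gaussian)
  note sets [measurable_cong] = is_centered_gaussianD(2)[OF assms(1) M]
  have "measure M {x \<in> space M. \<forall>k\<in>K. x k \<in> {y. eps k * y < 0}} =
     measure std_gaussian {x \<in> space (std_gaussian :: 'a measure). \<forall>k\<in>K. u k \<bullet> x \<in> {y. eps k * y < 0}}"
  proof (rule measure_rectangle_eqI_char[OF assms(1) M.finite_measure_axioms G.finite_measure_axioms])
    show "(CLINT x|M. iexp (\<Sum>k\<in>K. t k * x k)) = (CLINT x|std_gaussian. iexp (\<Sum>k\<in>K. t k * (u k \<bullet> x)))" for t
      unfolding is_centered_gaussianD(3)[OF assms(1) M] integral_iexp_std_gaussian_family
      by (simp add: u S_def cong: sum.cong)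
  qed measurable
  then show ?thesis
    using False sets_eq_imp_space_eq[OF sets] by (simp add: gfun_def M_def S_def)
qed

text \<open>The family is compared with one on two independent copies of the space, where
  \<open>I\<close> reads the first copy and \<open>J\<close> the second. Orthogonality removes the
  cross terms from the exponent, so the characteristic functions agree; on the product space the
  event is a product set.\<close>

lemma std_gaussian_orthogonal_indep:
  fixes u :: "'k \<Rightarrow> 'a::euclidean_space"
  assumes fin: "finite I" "finite J" and "I \<inter> J = {}"
    and orth: "\<And>i j. i \<in> I \<Longrightarrow> j \<in> J \<Longrightarrow> u i \<bullet> u j = 0"
    and B: "\<And>k. k \<in> I \<union> J \<Longrightarrow> B k \<in> sets borel"
  shows "measure std_gaussian {x :: 'a. \<forall>k\<in>I \<union> J. u k \<bullet> x \<in> B k} =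
    measure std_gaussian {x :: 'a. \<forall>k\<in>I. u k \<bullet> x \<in> B k} * measure std_gaussian {x :: 'a. \<forall>k\<in>J. u k \<bullet> x \<in> B k}"
proof -
  let ?G = "std_gaussian :: 'a measure"
  interpret G: prob_space ?G by (rule prob_space_std_gaussian)
  interpret GG: pair_prob_space ?G ?G ..
  define Y where "Y k z = (if k \<in> I then u k \<bullet> fst z else u k \<bullet> snd z)" for k and z :: "'a \<times> 'a"
  have Y [measurable]: "Y k \<in> borel_measurable (?G \<Otimes>\<^sub>M ?G)" for k
    unfolding Y_def by measurable
  have [measurable]: "Measurable.pred borel (\<lambda>x. \<forall>k\<in>I. u k \<bullet> x \<in> B k)"
    "Measurable.pred borel (\<lambda>x. \<forall>k\<in>J. u k \<bullet> x \<in> B k)"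
    using fin B by measurable
  have "measure ?G {x \<in> space ?G. \<forall>k\<in>I \<union> J. u k \<bullet> x \<in> B k} =
    measure (?G \<Otimes>\<^sub>M ?G) {z \<in> space (?G \<Otimes>\<^sub>M ?G). \<forall>k\<in>I \<union> J. Y k z \<in> B k}"
  proof (rule measure_rectangle_eqI_char[OF _ G.finite_measure_axioms GG.finite_measure_axioms])
    fix t
    have IJ: "(\<Sum>k\<in>I \<union> J. h k) = (\<Sum>k\<in>I. h k) + (\<Sum>k\<in>J. h k)" for h :: "'k \<Rightarrow> real"
      using fin \<open>I \<inter> J = {}\<close> by (rule sum.union_disjoint)
    have JI: "k \<notin> I" if "k \<in> J" for k using that \<open>I \<inter> J = {}\<close> by auto
    have cross: "(\<Sum>k\<in>I. \<Sum>l\<in>J. t k * t l * (u k \<bullet> u l)) = 0" "(\<Sum>k\<in>J. \<Sum>l\<in>I. t k * t l * (u k \<bullet> u l)) = 0"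
      using orth by (auto intro!: sum.neutral) (metis inner_commute)
    have "(CLINT z|?G \<Otimes>\<^sub>M ?G. iexp (\<Sum>k\<in>I \<union> J. t k * Y k z)) =
       (CLINT z|?G \<Otimes>\<^sub>M ?G. iexp (\<Sum>k\<in>I. t k * (u k \<bullet> fst z)) * iexp (\<Sum>k\<in>J. t k * (u k \<bullet> snd z)))"
      unfolding IJ by (simp add: Y_def JI exp_add[symmetric] distrib_left cong: sum.cong)
    also have "\<dots> = (CLINT x|?G. CLINT y|?G. iexp (\<Sum>k\<in>I. t k * (u k \<bullet> x)) * iexp (\<Sum>k\<in>J. t k * (u k \<bullet> y)))"
      by (subst GG.integral_fst'[symmetric], rule GG.P.integrable_const_bound[of _ 1])
         (auto simp: norm_mult)
    also have "\<dots> = (CLINT x|?G. iexp (\<Sum>k\<in>I. t k * (u k \<bullet> x))) * (CLINT y|?G. iexp (\<Sum>k\<in>J. t k * (u k \<bullet> y)))"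
      by (simp del: of_real_sum of_real_mult)
    also have "\<dots> = complex_of_real (exp (- (\<Sum>k\<in>I. \<Sum>l\<in>I. t k * t l * (u k \<bullet> u l)) / 2 +
        - (\<Sum>k\<in>J. \<Sum>l\<in>J. t k * t l * (u k \<bullet> u l)) / 2))"
      unfolding integral_iexp_std_gaussian_family exp_add of_real_mult ..
    also have "\<dots> = (CLINT x|?G. iexp (\<Sum>k\<in>I \<union> J. t k * (u k \<bullet> x)))"
      unfolding integral_iexp_std_gaussian_family unfolding IJ
      by (simp add: sum.distrib cross)
    finally show "(CLINT x|?G. iexp (\<Sum>k\<in>I \<union> J. t k * (u k \<bullet> x))) =
      (CLINT z|?G \<Otimes>\<^sub>M ?G. iexp (\<Sum>k\<in>I \<union> J. t k * Y k z))" by simp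
  qed (use fin B in \<open>auto\<close>)
  also have "{z \<in> space (?G \<Otimes>\<^sub>M ?G). \<forall>k\<in>I \<union> J. Y k z \<in> B k} =
      {x. \<forall>k\<in>I. u k \<bullet> x \<in> B k} \<times> {x. \<forall>k\<in>J. u k \<bullet> x \<in> B k}"
    using \<open>I \<inter> J = {}\<close> by (auto simp: Y_def space_pair_measure split: if_splits)
  also have "measure (?G \<Otimes>\<^sub>M ?G) \<dots> =
    measure ?G {x. \<forall>k\<in>I. u k \<bullet> x \<in> B k} * measure ?G {x. \<forall>k\<in>J. u k \<bullet> x \<in> B k}"
    by (subst measure_def, subst G.emeasure_pair_measure_Times) (auto simp: measure_def enn2real_mult)
  finally show ?thesis by simp
qed

text \<open>The variable \<open>u \<bullet> x\<close> is distributed as \<open>norm u\<close> times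
  a standard normal variable, which has no atom at 0. The index set \<open>{()}\<close> makes this a
  case of the rectangle lemma.\<close>

lemma std_gaussian_hyperplane_null:
  fixes u :: "'a::euclidean_space"
  assumes "u \<noteq> 0"
  shows "AE x in std_gaussian. u \<bullet> x \<noteq> 0"
proof -
  let ?G = "std_gaussian :: 'a measure"
  interpret G: prob_space ?G by (rule prob_space_std_gaussian)
  have "measure ?G {x \<in> space ?G. \<forall>k\<in>{()}. u \<bullet> x \<in> {0}} =
    measure std_normal_distribution {y \<in> space std_normal_distribution. \<forall>k\<in>{()}. norm u * y \<in> {0}}"
  proof (rule measure_rectangle_eqI_char[OF _ G.finite_measure_axioms std_normal.finite_measure_axioms])
    show "(CLINT x|?G. iexp (\<Sum>k\<in>{()}. t k * (u \<bullet> x))) =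
        (CLINT y|std_normal_distribution. iexp (\<Sum>k\<in>{()}. t k * (norm u * y)))" for t :: "unit \<Rightarrow> real"
      using integral_iexp_std_gaussian_family[where K = "{()}" and t = t and u = "\<lambda>_. u"]
        fun_cong[OF char_std_normal_distribution, of "t () * norm u"]
      by (simp add: char_def power2_eq_square dot_square_norm mult_ac)
  qed auto
  also have "\<dots> = 0"
    using assms
    by (simp add: measure_def emeasure_density)
  finally show ?thesis
    by (intro AE_I[of _ _ "{x. u \<bullet> x = 0}"]) (auto simp: G.emeasure_eq_measure)
qed

section \<open>Simplicial cones\<close>

lemma convex_cone_hull_image_iff:
  assumes "finite I"
  shows "x \<in> convex_cone hull (e ` I) \<longleftrightarrow> (\<exists>a. (\<forall>i\<in>I. 0 \<le> a i) \<and> x = (\<Sum>i\<in>I. a i *\<^sub>R e i))"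
proof
  define T where "T = {x. \<exists>a. (\<forall>i\<in>I. 0 \<le> a i) \<and> x = (\<Sum>i\<in>I. a i *\<^sub>R e i)}"
  have "convex_cone T"
    unfolding convex_cone_iff
  proof (intro conjI ballI allI impI)
    show "0 \<in> T" by (auto simp: T_def intro!: exI[of _ "\<lambda>_. 0"])
    fix x y assume "x \<in> T" "y \<in> T"
    then obtain a b where "\<forall>i\<in>I. 0 \<le> a i" "x = (\<Sum>i\<in>I. a i *\<^sub>R e i)"
      "\<forall>i\<in>I. 0 \<le> b i" "y = (\<Sum>i\<in>I. b i *\<^sub>R e i)"
      by (auto simp: T_def)
    then show "x + y \<in> T"
      by (auto simp: T_def sum.distrib scaleR_add_left intro!: exI[of _ "\<lambda>i. a i + b i"])
  next
    fix x c assume "x \<in> T" "(0::real) \<le> c"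
    then obtain a where "\<forall>i\<in>I. 0 \<le> a i" "x = (\<Sum>i\<in>I. a i *\<^sub>R e i)" by (auto simp: T_def)
    then show "c *\<^sub>R x \<in> T" using \<open>0 \<le> c\<close>
      by (auto simp: T_def scaleR_sum_right intro!: exI[of _ "\<lambda>i. c * a i"])
  qed
  moreover have "e ` I \<subseteq> T"
  proof
    fix y assume "y \<in> e ` I"
    then obtain i where "i \<in> I" "y = e i" by auto
    then show "y \<in> T" using assms
      by (auto simp: T_def if_distrib[of "\<lambda>c. c *\<^sub>R _"] cong: if_cong
          intro!: exI[of _ "\<lambda>j. if j = i then 1 else 0"])
  qed
  ultimately have "convex_cone hull (e ` I) \<subseteq> T" by (intro hull_minimal)
  moreover assume "x \<in> convex_cone hull (e ` I)"
  ultimately show "\<exists>a. (\<forall>i\<in>I. 0 \<le> a i) \<and> x = (\<Sum>i\<in>I. a i *\<^sub>R e i)" by (auto simp: T_def)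
next
  assume "\<exists>a. (\<forall>i\<in>I. 0 \<le> a i) \<and> x = (\<Sum>i\<in>I. a i *\<^sub>R e i)"
  then obtain a where a: "\<forall>i\<in>I. 0 \<le> a i" and x: "x = (\<Sum>i\<in>I. a i *\<^sub>R e i)" by blast
  have "(\<Sum>i\<in>J. a i *\<^sub>R e i) \<in> convex_cone hull (e ` I)" if "finite J" "J \<subseteq> I" for J
    using that
  proof (induction J rule: finite_induct)
    case (insert i J)
    then have "a i *\<^sub>R e i + (\<Sum>i\<in>J. a i *\<^sub>R e i) \<in> convex_cone hull (e ` I)"
      using a by (intro convex_cone_hull_add convex_cone_hull_mul) (auto intro: hull_inc)
    then show ?case using insert by simp
  qed (simp add: convex_cone_hull_contains_0)
  then show "x \<in> convex_cone hull (e ` I)" using assms x by auto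
qed

section \<open>Faces of convex cones\<close>

lemma face_of_convex_cone:
  assumes "convex_cone C" "F face_of C" "F \<noteq> {}"
  shows "convex_cone F"
proof -
  have "conic F" using assms(1,2) by (auto simp: convex_cone_def intro: face_of_conic)
  moreover have "convex F" using assms(2) by (rule face_of_imp_convex)
  ultimately show ?thesis using assms(3) by (simp add: convex_cone_def)
qed

text \<open>The midpoint of \<open>x\<close> and \<open>y\<close> is half their sum, so it lies in
  \<open>F\<close>. Unless \<open>x = y\<close>, it is interior to the segment between them and the
  face property applies.\<close>

lemma face_of_convex_cone_summand:
  assumes "convex_cone C" "F face_of C" "x \<in> C" "y \<in> C" "x + y \<in> F"
  shows "x \<in> F"
proof -
  have F: "convex_cone F" using assms by (intro face_of_convex_cone[OF assms(1,2)]) auto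
  have mid: "midpoint x y \<in> F"
    unfolding midpoint_def using F assms(5) by (intro convex_cone_scaleR) auto
  show ?thesis
  proof (cases "x = y")
    case True
    then show ?thesis using mid by simp
  next
    case False
    then show ?thesis using face_ofD[OF assms(2) _ assms(3,4) mid] by simp
  qed
qed

text \<open>The functionals \<open>\<phi> i\<close> are dual to the generators, so having them
  encodes linear independence. They turn the coefficients of a point of the cone into linear
  functions of the point instead of chosen witnesses.\<close>

locale simplicial_cone =
  fixes D :: "'i set" and e :: "'i \<Rightarrow> 'a::euclidean_space" and \<phi> :: "'i \<Rightarrow> 'a \<Rightarrow> real"
  assumes finite_D: "finite D"
    and linear_\<phi>: "\<And>i. linear (\<phi> i)"
    and \<phi>_e: "\<And>i j. i \<in> D \<Longrightarrow> j \<in> D \<Longrightarrow> \<phi> i (e j) = (if i = j then 1 else 0)"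
begin

abbreviation cone_of :: "'i set \<Rightarrow> 'a set" where
  "cone_of I \<equiv> convex_cone hull (e ` I)"

lemma \<phi>_sum:
  assumes "I \<subseteq> D" "i \<in> D"
  shows "\<phi> i (\<Sum>j\<in>I. a j *\<^sub>R e j) = (if i \<in> I then a i else 0)"
proof -
  have "\<phi> i (\<Sum>j\<in>I. a j *\<^sub>R e j) = (\<Sum>j\<in>I. if i = j then a j else 0)"
    using assms by (auto simp: linear_sum[OF linear_\<phi>] linear_cmul[OF linear_\<phi>] \<phi>_e subset_iff intro!: sum.cong)
  also have "\<dots> = (if i \<in> I then a i else 0)"
    using assms finite_D finite_subset by (subst sum.delta') auto
  finally show ?thesis .
qed

lemma cone_of_iff:
  assumes "I \<subseteq> D"
  shows "x \<in> cone_of I \<longleftrightarrow> x = (\<Sum>i\<in>I. \<phi> i x *\<^sub>R e i) \<and> (\<forall>i\<in>I. 0 \<le> \<phi> i x)"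
proof -
  have "finite I" using assms finite_D finite_subset by blast
  moreover have "\<phi> i (\<Sum>j\<in>I. a j *\<^sub>R e j) = a i" if "i \<in> I" for a i
    using that assms by (subst \<phi>_sum) auto
  ultimately show ?thesis
    by (auto simp: convex_cone_hull_image_iff)
qed

lemma \<phi>_cone_of:
  assumes "I \<subseteq> D" "x \<in> cone_of I" "i \<in> D"
  shows "0 \<le> \<phi> i x" "i \<notin> I \<Longrightarrow> \<phi> i x = 0"
proof -
  have "x = (\<Sum>i\<in>I. \<phi> i x *\<^sub>R e i)" "\<forall>i\<in>I. 0 \<le> \<phi> i x" using assms cone_of_iff by blast+
  then show "0 \<le> \<phi> i x" "i \<notin> I \<Longrightarrow> \<phi> i x = 0"
    using \<phi>_sum[OF assms(1,3), of "\<lambda>j. \<phi> j x"] by (auto split: if_splits)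
qed

lemma cone_of_subset_iff:
  assumes "I \<subseteq> D"
  shows "x \<in> cone_of I \<longleftrightarrow> x \<in> cone_of D \<and> (\<forall>i\<in>D - I. \<phi> i x = 0)"
proof
  assume "x \<in> cone_of I"
  moreover have "cone_of I \<subseteq> cone_of D" using assms by (intro hull_mono image_mono)
  ultimately show "x \<in> cone_of D \<and> (\<forall>i\<in>D - I. \<phi> i x = 0)" using \<phi>_cone_of[OF assms] by auto
next
  assume x: "x \<in> cone_of D \<and> (\<forall>i\<in>D - I. \<phi> i x = 0)"
  then have "x = (\<Sum>i\<in>D. \<phi> i x *\<^sub>R e i)" using cone_of_iff[OF subset_refl] by blast
  also have "\<dots> = (\<Sum>i\<in>I. \<phi> i x *\<^sub>R e i)"
    using x assms finite_D by (intro sum.mono_neutral_right) auto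
  finally show "x \<in> cone_of I" using x assms cone_of_iff[OF assms] cone_of_iff[OF subset_refl] by blast
qed

lemma cone_of_face:
  assumes "I \<subseteq> D"
  shows "cone_of I face_of cone_of D"
  unfolding face_of_def
proof (intro conjI ballI impI)
  show "cone_of I \<subseteq> cone_of D" using assms by (intro hull_mono image_mono)
  show "convex (cone_of I)" by (rule convex_convex_cone_hull)
  fix a b x assume *: "a \<in> cone_of D" "b \<in> cone_of D" "x \<in> cone_of I" "x \<in> open_segment a b"
  then obtain t where t: "0 < t" "t < 1" "x = (1 - t) *\<^sub>R a + t *\<^sub>R b" by (auto simp: in_segment)
  have "\<phi> i a = 0 \<and> \<phi> i b = 0" if "i \<in> D - I" for i
  proof -
    have "(1 - t) * \<phi> i a + t * \<phi> i b = 0"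
      using \<phi>_cone_of(2)[OF assms *(3)] that t(3)
      by (auto simp: linear_add[OF linear_\<phi>] linear_cmul[OF linear_\<phi>])
    moreover have "0 \<le> \<phi> i a" "0 \<le> \<phi> i b" using * that \<phi>_cone_of(1)[OF subset_refl] by auto
    ultimately show ?thesis using t(1,2) by (simp add: add_nonneg_eq_0_iff)
  qed
  then show "a \<in> cone_of I" "b \<in> cone_of I" using * cone_of_subset_iff[OF assms] by auto
qed

text \<open>If the coordinate of \<open>x\<close> in \<open>F\<close> at \<open>i\<close> is
  nonzero, then \<open>x\<close> is a positive multiple of \<open>e i\<close> plus a remainder in
  the cone. A face contains both summands, hence also \<open>e i\<close>; so only generators in
  \<open>F\<close> occur in \<open>x\<close>.\<close>

lemma face_eq_cone_of:
  assumes "F face_of cone_of D" "F \<noteq> {}"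
  shows "F = cone_of {i\<in>D. e i \<in> F}"
proof
  let ?I = "{i\<in>D. e i \<in> F}"
  note C = convex_cone_convex_cone_hull[of "e ` D"]
  have F: "convex_cone F" by (rule face_of_convex_cone[OF C assms])
  show "cone_of ?I \<subseteq> F" using F by (intro hull_minimal) auto
  show "F \<subseteq> cone_of ?I"
  proof
    fix x assume x: "x \<in> F"
    then have xD: "x \<in> cone_of D" using assms(1) face_of_imp_subset by blast
    have "e i \<in> F" if i: "i \<in> D" and nz: "\<phi> i x \<noteq> 0" for i
    proof -
      have pos: "\<phi> i x > 0" using \<phi>_cone_of(1)[OF subset_refl xD i] nz by simp
      have eD: "e j \<in> cone_of D" if "j \<in> D" for j using that by (intro hull_inc) auto
      have rest: "(\<Sum>j\<in>D - {i}. \<phi> j x *\<^sub>R e j) \<in> cone_of D"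
        using finite_D \<phi>_cone_of(1)[OF subset_refl xD]
        by (subst convex_cone_hull_image_iff)
           (auto intro!: exI[of _ "\<lambda>j. if j = i then 0 else \<phi> j x"] sum.mono_neutral_cong_left
             split: if_splits)
      have "x = (\<Sum>j\<in>D. \<phi> j x *\<^sub>R e j)" using xD cone_of_iff[OF subset_refl] by blast
      also have "\<dots> = \<phi> i x *\<^sub>R e i + (\<Sum>j\<in>D - {i}. \<phi> j x *\<^sub>R e j)"
        using finite_D i by (rule sum.remove)
      finally have "\<phi> i x *\<^sub>R e i + (\<Sum>j\<in>D - {i}. \<phi> j x *\<^sub>R e j) \<in> F"
        using x by simp
      moreover have "\<phi> i x *\<^sub>R e i \<in> cone_of D"
        using eD[OF i] pos by (intro convex_cone_hull_mul) auto
      ultimately have "\<phi> i x *\<^sub>R e i \<in> F"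
        using face_of_convex_cone_summand[OF C assms(1) _ rest] by blast
      then show ?thesis
        using convex_cone_scaleR[OF F, of "1 / \<phi> i x" "\<phi> i x *\<^sub>R e i"] pos by simp
    qed
    then show "x \<in> cone_of ?I"
      using xD cone_of_subset_iff[of ?I x] by blast
  qed
qed

lemma e_in_cone_of_iff:
  assumes "I \<subseteq> D" "i \<in> D"
  shows "e i \<in> cone_of I \<longleftrightarrow> i \<in> I"
proof
  assume "e i \<in> cone_of I"
  then show "i \<in> I" using \<phi>_cone_of(2)[OF assms(1) _ assms(2), of "e i"] \<phi>_e[OF assms(2,2)] by auto
qed (auto intro: hull_inc)

lemma inj_on_cone_of: "inj_on cone_of (Pow D)"
proof (rule inj_onI)
  fix I J assume *: "I \<in> Pow D" "J \<in> Pow D" "cone_of I = cone_of J"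
  then have "i \<in> I \<longleftrightarrow> i \<in> J" if "i \<in> D" for i
    using e_in_cone_of_iff[of I i] e_in_cone_of_iff[of J i] that by auto
  then show "I = J" using * by blast
qed

lemma aff_dim_cone_of:
  assumes "I \<subseteq> D"
  shows "aff_dim (cone_of I) = int (card I)"
proof -
  have fin: "finite I" using assms finite_D finite_subset by blast
  have inj: "inj_on e I"
    using assms by (auto intro!: inj_onI) (metis \<phi>_e subsetD zero_neq_one)
  have indep: "independent (e ` I)"
  proof (rule independent_if_scalars_zero)
    fix f x assume sum: "(\<Sum>x\<in>e ` I. f x *\<^sub>R x) = 0" and x: "x \<in> e ` I"
    then obtain i where i: "i \<in> I" "x = e i" by auto
    have "(\<Sum>j\<in>I. f (e j) *\<^sub>R e j) = 0" using sum inj by (simp add: sum.reindex)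
    then have "\<phi> i (\<Sum>j\<in>I. f (e j) *\<^sub>R e j) = 0" using linear_0[OF linear_\<phi>] by simp
    then show "f x = 0" using i assms by (subst (asm) \<phi>_sum) auto
  qed (use fin in auto)
  have "span (cone_of I) = span (e ` I)"
  proof (rule antisym)
    have "cone_of I \<subseteq> span (e ` I)"
      by (intro hull_minimal subspace_imp_convex_cone) (auto intro: span_base)
    then show "span (cone_of I) \<subseteq> span (e ` I)" by (simp add: span_minimal)
    show "span (e ` I) \<subseteq> span (cone_of I)" by (intro span_mono hull_subset)
  qed
  then have "dim (cone_of I) = card I"
    using dim_span[of "cone_of I"] dim_span_eq_card_independent[OF indep] card_image[OF inj] by simp
  moreover have "0 \<in> affine hull (cone_of I)"
    by (intro hull_inc convex_cone_hull_contains_0)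
  ultimately show ?thesis by (simp add: aff_dim_zero)
qed

lemma faces_eq:
  "{F. F face_of cone_of D \<and> aff_dim F = int k} = cone_of ` {I. I \<subseteq> D \<and> card I = k}"
proof (intro equalityI subsetI)
  fix F assume "F \<in> {F. F face_of cone_of D \<and> aff_dim F = int k}"
  then have F: "F face_of cone_of D" "aff_dim F = int k" by auto
  \<comment> \<open>The empty face has affine dimension -1, which is never of the form
    \<open>int k\<close>.\<close>
  then have "F \<noteq> {}" by auto
  then have eq: "F = cone_of {i\<in>D. e i \<in> F}" by (rule face_eq_cone_of[OF F(1)])
  moreover have "card {i\<in>D. e i \<in> F} = k"
    using aff_dim_cone_of[of "{i\<in>D. e i \<in> F}"] F(2) unfolding eq[symmetric] by simp
  ultimately show "F \<in> cone_of ` {I. I \<subseteq> D \<and> card I = k}" by blast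
qed (auto simp: cone_of_face aff_dim_cone_of)

text \<open>The criterion is that the segment from any \<open>y\<close> of the cone to
  \<open>x\<close> can be prolonged beyond \<open>x\<close> inside the cone. Prolonging from the
  generator \<open>e i\<close> forces coordinate \<open>i\<close> of \<open>x\<close> to be
  positive; conversely, positive coordinates leave room for a small step.\<close>

lemma rel_interior_cone_of:
  assumes "I \<subseteq> D"
  shows "x \<in> rel_interior (cone_of I) \<longleftrightarrow> x = (\<Sum>i\<in>I. \<phi> i x *\<^sub>R e i) \<and> (\<forall>i\<in>I. 0 < \<phi> i x)"
proof -
  have fin: "finite I" using assms finite_D finite_subset by blast
  note iff = convex_rel_interior_iff[OF convex_convex_cone_hull convex_cone_hull_nonempty, of x "e ` I"]
  show ?thesis
  proof
    assume x: "x \<in> rel_interior (cone_of I)"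
    then have xI: "x \<in> cone_of I" using rel_interior_subset by blast
    have "0 < \<phi> i x" if i: "i \<in> I" for i
    proof -
      have "e i \<in> cone_of I" using i by (intro hull_inc) auto
      then obtain t where t: "t > 1" "(1 - t) *\<^sub>R e i + t *\<^sub>R x \<in> cone_of I" using x iff by blast
      have iD: "i \<in> D" using i assms by auto
      have "0 \<le> (1 - t) * \<phi> i (e i) + t * \<phi> i x"
        using \<phi>_cone_of(1)[OF assms t(2) iD] by (simp add: linear_add[OF linear_\<phi>] linear_cmul[OF linear_\<phi>])
      then have "0 < t * \<phi> i x" using t(1) \<phi>_e[OF iD iD] by simp
      then show ?thesis using t(1) by (simp add: zero_less_mult_iff)
    qed
    then show "x = (\<Sum>i\<in>I. \<phi> i x *\<^sub>R e i) \<and> (\<forall>i\<in>I. 0 < \<phi> i x)"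
      using xI cone_of_iff[OF assms] by blast
  next
    assume x: "x = (\<Sum>i\<in>I. \<phi> i x *\<^sub>R e i) \<and> (\<forall>i\<in>I. 0 < \<phi> i x)"
    show "x \<in> rel_interior (cone_of I)"
      unfolding iff
    proof
      fix y assume "y \<in> cone_of I"
      then have y: "y = (\<Sum>i\<in>I. \<phi> i y *\<^sub>R e i)" "\<forall>i\<in>I. 0 \<le> \<phi> i y" using cone_of_iff[OF assms] by blast+
      obtain s where s: "0 < s" "\<And>i. i \<in> I \<Longrightarrow> s * \<phi> i y \<le> \<phi> i x"
      proof
        \<comment> \<open>The element 1 covers an empty \<open>I\<close>, and the denominator
          \<open>1 + \<phi> i y\<close> is positive even where the coordinate of \<open>y\<close>
          vanishes.\<close>
        define s where "s = Min (insert 1 ((\<lambda>i. \<phi> i x / (1 + \<phi> i y)) ` I))"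
        show "0 < s" unfolding s_def using x y fin by (auto intro!: divide_pos_pos add_pos_nonneg)
        fix i assume i: "i \<in> I"
        have "s \<le> \<phi> i x / (1 + \<phi> i y)" unfolding s_def using fin i by (intro Min_le) auto
        then have "s * (1 + \<phi> i y) \<le> \<phi> i x"
          using y i by (subst (asm) pos_le_divide_eq) (auto intro!: add_pos_nonneg)
        then show "s * \<phi> i y \<le> \<phi> i x" using \<open>0 < s\<close> by (simp add: distrib_left)
      qed
      have "(1 - (1 + s)) *\<^sub>R y + (1 + s) *\<^sub>R x
          = (\<Sum>i\<in>I. ((1 - (1 + s)) * \<phi> i y + (1 + s) * \<phi> i x) *\<^sub>R e i)"
        by (subst y(1), subst x[THEN conjunct1])
           (simp only: scaleR_sum_right scaleR_add_left sum.distrib scaleR_scaleR)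
      moreover have "0 \<le> (1 - (1 + s)) * \<phi> i y + (1 + s) * \<phi> i x" if "i \<in> I" for i
      proof -
        have "0 \<le> s * \<phi> i x" using s(1) x that by (intro mult_nonneg_nonneg) auto
        then show ?thesis using s(2)[OF that] by (simp add: algebra_simps)
      qed
      ultimately have "(1 - (1 + s)) *\<^sub>R y + (1 + s) *\<^sub>R x \<in> cone_of I"
        unfolding convex_cone_hull_image_iff[OF fin]
        by (intro exI[of _ "\<lambda>i. (1 - (1 + s)) * \<phi> i y + (1 + s) * \<phi> i x"] conjI ballI)
      then show "\<exists>t>1. (1 - t) *\<^sub>R y + t *\<^sub>R x \<in> cone_of I" using s(1) by (intro exI[of _ "1 + s"]) auto
    qed
  qed
qed

section \<open>Nearest points of simplicial cones\<close>

lemma closest_point_cone_of_iff: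
  "closest_point (cone_of D) x = q \<longleftrightarrow>
    q \<in> cone_of D \<and> (x - q) \<bullet> q = 0 \<and> (\<forall>i\<in>D. (x - q) \<bullet> e i \<le> 0)"
proof -
  have closed: "closed (cone_of D)" using finite_D by (intro closed_convex_cone_hull) auto
  note convex = convex_convex_cone_hull[of "e ` D"]
  show ?thesis
  proof
    assume q: "closest_point (cone_of D) x = q"
    have qD: "q \<in> cone_of D" unfolding q[symmetric] using closed
      by (rule closest_point_in_set) (rule convex_cone_hull_nonempty)
    have dot: "(x - q) \<bullet> (z - q) \<le> 0" if "z \<in> cone_of D" for z
      using closest_point_dot[OF convex closed that, of x] q by simp
    \<comment> \<open>The test points \<open>2 *\<^sub>R q\<close> and 0 of the cone bound
      \<open>(x - q) \<bullet> q\<close> from both sides; the test point \<open>q + e i\<close> then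
      isolates the generator.\<close>
    have "(x - q) \<bullet> (2 *\<^sub>R q - q) \<le> 0" using qD by (intro dot convex_cone_hull_mul) auto
    moreover have "(x - q) \<bullet> (0 - q) \<le> 0" by (intro dot convex_cone_hull_contains_0)
    ultimately have "(x - q) \<bullet> q = 0" by (simp add: inner_simps)
    moreover have "(x - q) \<bullet> e i \<le> 0" if "i \<in> D" for i
      using dot[OF convex_cone_hull_add[OF qD hull_inc[of "e i"]]] that by auto
    ultimately show "q \<in> cone_of D \<and> (x - q) \<bullet> q = 0 \<and> (\<forall>i\<in>D. (x - q) \<bullet> e i \<le> 0)" using qD by blast
  next
    assume q: "q \<in> cone_of D \<and> (x - q) \<bullet> q = 0 \<and> (\<forall>i\<in>D. (x - q) \<bullet> e i \<le> 0)"
    have "dist x q \<le> dist x z" if z: "z \<in> cone_of D" for z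
    proof -
      have "(x - q) \<bullet> z = (\<Sum>i\<in>D. \<phi> i z * ((x - q) \<bullet> e i))"
        using z cone_of_iff[OF subset_refl, of z] by (metis (no_types, lifting) inner_scaleR_right inner_sum_right sum.cong)
      also have "\<dots> \<le> 0"
        using q z \<phi>_cone_of(1)[OF subset_refl z] by (intro sum_nonpos mult_nonneg_nonpos) auto
      finally have "(x - q) \<bullet> (q - z) \<ge> 0" using q by (simp add: inner_diff_right)
      moreover have "(norm (x - z))\<^sup>2 = (norm (x - q))\<^sup>2 + 2 * ((x - q) \<bullet> (q - z)) + (norm (q - z))\<^sup>2"
        by (simp add: power2_norm_eq_inner inner_simps inner_commute)
      ultimately have "(norm (x - q))\<^sup>2 \<le> (norm (x - z))\<^sup>2" using zero_le_power2[of "norm (q - z)"] by linarith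
      then show ?thesis by (simp add: dist_norm power2_le_iff_abs_le)
    qed
    then have "q = closest_point (cone_of D) x" using q by (intro closest_point_unique convex closed) auto
    then show "closest_point (cone_of D) x = q" by simp
  qed
qed

text \<open>Here \<open>w\<close> is the basis dual to \<open>e\<close> within the span of the face,
  and \<open>r j\<close> is the part of \<open>e j\<close> orthogonal to that span. For a nearest
  point \<open>q\<close> in the open face, \<open>x - q\<close> is orthogonal to the face. So the
  coordinates of \<open>q\<close> are \<open>w i \<bullet> x\<close>, and the remaining optimality
  conditions \<open>(x - q) \<bullet> e j \<le> 0\<close> become
  \<open>r j \<bullet> x \<le> 0\<close>.\<close>

lemma closest_point_in_rel_interior_iff:
  assumes "I \<subseteq> D"
    and w: "\<And>i. i \<in> I \<Longrightarrow> w i \<in> span (e ` I)"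
      "\<And>i k. i \<in> I \<Longrightarrow> k \<in> I \<Longrightarrow> w i \<bullet> e k = (if i = k then 1 else 0)"
    and r: "\<And>j. j \<in> D - I \<Longrightarrow> e j - r j \<in> span (e ` I)"
      "\<And>j k. j \<in> D - I \<Longrightarrow> k \<in> I \<Longrightarrow> r j \<bullet> e k = 0"
  shows "closest_point (cone_of D) x \<in> rel_interior (cone_of I) \<longleftrightarrow>
    (\<forall>i\<in>I. 0 < w i \<bullet> x) \<and> (\<forall>j\<in>D - I. r j \<bullet> x \<le> 0)"
proof -
  have fin: "finite I" using assms finite_D finite_subset by blast
  have orth_span: "y \<bullet> z = 0" if "\<And>k. k \<in> I \<Longrightarrow> y \<bullet> e k = 0" "z \<in> span (e ` I)" for y z
    using orthogonal_to_span[OF that(2), of y] that(1) by (auto simp: orthogonal_def)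
  have w_sum: "w i \<bullet> (\<Sum>k\<in>I. b k *\<^sub>R e k) = b i" if "i \<in> I" for i b
    using that fin by (simp add: inner_sum_right w(2) if_distrib[of "(*) _"] cong: if_cong)
  have r_sum: "r j \<bullet> (\<Sum>k\<in>I. b k *\<^sub>R e k) = 0" if "j \<in> D - I" for j b
    using that by (simp add: inner_sum_right r(2))
  have r_eq: "r j \<bullet> y = e j \<bullet> y" if "j \<in> D - I" "\<And>k. k \<in> I \<Longrightarrow> y \<bullet> e k = 0" for j y
    using orth_span[OF that(2) r(1)[OF that(1)]] by (simp add: inner_simps inner_commute)
  show ?thesis
  proof
    define q where "q = closest_point (cone_of D) x"
    assume "closest_point (cone_of D) x \<in> rel_interior (cone_of I)"
    then have b: "q = (\<Sum>k\<in>I. \<phi> k q *\<^sub>R e k)" "\<forall>k\<in>I. 0 < \<phi> k q"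
      unfolding q_def using rel_interior_cone_of[OF assms(1)] by blast+
    have q: "(x - q) \<bullet> q = 0" "\<forall>i\<in>D. (x - q) \<bullet> e i \<le> 0"
      using closest_point_cone_of_iff[of x q] by (simp_all add: q_def)
    have "(\<Sum>k\<in>I. \<phi> k q * ((x - q) \<bullet> e k)) = 0"
      using q(1) b(1) by (metis (no_types, lifting) inner_scaleR_right inner_sum_right sum.cong)
    then have "(\<Sum>k\<in>I. - (\<phi> k q * ((x - q) \<bullet> e k))) = 0" by (simp add: sum_negf)
    \<comment> \<open>Complementary slackness: the terms are nonnegative and sum to zero, and the
      coordinates of \<open>q\<close> are positive.\<close>
    then have "\<forall>k\<in>I. - (\<phi> k q * ((x - q) \<bullet> e k)) = 0"
      using q(2) b(2) assms(1) fin
      by (subst (asm) sum_nonneg_eq_0_iff) (auto intro!: mult_nonneg_nonpos simp: subset_iff less_imp_le)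
    then have orth: "(x - q) \<bullet> e k = 0" if "k \<in> I" for k using b(2) that by fastforce
    have "w i \<bullet> x > 0" if i: "i \<in> I" for i
    proof -
      have "w i \<bullet> (x - q) = 0" using orth_span[OF orth w(1)[OF i]] by (simp add: inner_commute)
      moreover have "w i \<bullet> q = \<phi> i q" using w_sum[OF i, of "\<lambda>k. \<phi> k q"] b(1) by simp
      ultimately show ?thesis using b(2) i by (simp add: inner_diff_right)
    qed
    moreover have "r j \<bullet> x \<le> 0" if j: "j \<in> D - I" for j
    proof -
      have "r j \<bullet> q = 0" using r_sum[OF j, of "\<lambda>k. \<phi> k q"] b(1) by simp
      then show ?thesis
        using r_eq[OF j orth] q(2) j by (simp add: inner_diff_right inner_commute)
    qed
    ultimately show "(\<forall>i\<in>I. 0 < w i \<bullet> x) \<and> (\<forall>j\<in>D - I. r j \<bullet> x \<le> 0)" by blast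
  next
    assume x: "(\<forall>i\<in>I. 0 < w i \<bullet> x) \<and> (\<forall>j\<in>D - I. r j \<bullet> x \<le> 0)"
    define q where "q = (\<Sum>i\<in>I. (w i \<bullet> x) *\<^sub>R e i)"
    have \<phi>_q: "\<phi> i q = w i \<bullet> x" if "i \<in> I" for i
      unfolding q_def using that assms(1) by (subst \<phi>_sum) auto
    have ri: "q \<in> rel_interior (cone_of I)"
      unfolding rel_interior_cone_of[OF assms(1)] using x \<phi>_q by (auto simp: q_def cong: sum.cong)
    have orth: "(x - q) \<bullet> e k = 0" if k: "k \<in> I" for k
    proof -
      \<comment> \<open>This \<open>y\<close> lies in the span of the face and is orthogonal to it,
        so it vanishes; the result is the expansion of \<open>e k\<close> in the dual basis
        \<open>w\<close>.\<close>
      define y where "y = e k - (\<Sum>i\<in>I. (e i \<bullet> e k) *\<^sub>R w i)"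
      have "y \<in> span (e ` I)"
        unfolding y_def using k w(1) by (intro span_diff span_sum span_scale) (auto intro: span_base)
      moreover have "y \<bullet> e m = 0" if "m \<in> I" for m
        using that fin
        by (simp add: y_def inner_diff_left inner_sum_left w(2) inner_commute[of "e k" "e m"]
            if_distrib[of "(*) _"] cong: if_cong)
      ultimately have "y \<bullet> y = 0" using orth_span by blast
      then have "e k = (\<Sum>i\<in>I. (e i \<bullet> e k) *\<^sub>R w i)" by (simp add: y_def)
      from arg_cong[OF this, of "\<lambda>z. z \<bullet> x"]
      have "e k \<bullet> x = (\<Sum>i\<in>I. (e i \<bullet> e k) * (w i \<bullet> x))"
        by (simp add: inner_sum_left)
      then show ?thesis by (simp add: inner_diff_left q_def inner_sum_left inner_commute[of x "e k"] mult.commute)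
    qed
    have "q \<in> cone_of D"
      using ri rel_interior_subset cone_of_subset_iff[OF assms(1)] by blast
    moreover have "(x - q) \<bullet> q = 0"
      by (subst (2) q_def) (simp add: inner_sum_right orth)
    moreover have "(x - q) \<bullet> e i \<le> 0" if "i \<in> D" for i
    proof (cases "i \<in> I")
      case False
      then have i: "i \<in> D - I" using that by auto
      have "(x - q) \<bullet> e i = r i \<bullet> (x - q)" using r_eq[OF i orth] by (simp add: inner_commute)
      also have "\<dots> = r i \<bullet> x" using r_sum[OF i] by (simp add: inner_diff_right q_def)
      finally show ?thesis using x i by simp
    qed (simp add: orth)
    ultimately have "closest_point (cone_of D) x = q" using closest_point_cone_of_iff by blast
    then show "closest_point (cone_of D) x \<in> rel_interior (cone_of I)" using ri by simp
  qed
qed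

end

lemma simplicial_cone_exists:
  fixes e :: "'i \<Rightarrow> 'a::euclidean_space"
  assumes "finite D" "inj_on e D" "independent (e ` D)"
  obtains \<phi> where "simplicial_cone D e \<phi>"
proof -
  have "\<exists>g. linear g \<and> (\<forall>x\<in>e ` D. g x = (if i = inv_into D e x then 1 else 0 :: real))" for i
    using linear_independent_extend[OF assms(3), of "\<lambda>x. if i = inv_into D e x then 1 else 0 :: real"]
    by blast
  then obtain \<phi> where "\<And>i. linear (\<phi> i) \<and> (\<forall>x\<in>e ` D. \<phi> i x = (if i = inv_into D e x then 1 else 0 :: real))"
    using choice[of "\<lambda>i g. linear g \<and> (\<forall>x\<in>e ` D. g x = (if i = inv_into D e x then 1 else 0 :: real))"]
    by blast
  then have "\<And>i. linear (\<phi> i)" "\<And>i j. j \<in> D \<Longrightarrow> \<phi> i (e j) = (if i = j then 1 else 0)"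
    using assms(2) by (simp_all add: inv_into_f_f)
  then have "simplicial_cone D e \<phi>" using assms(1) by (simp add: simplicial_cone_def)
  then show thesis by (rule that)
qed

section \<open>Orthocentric cones\<close>

text \<open>Makes the division by \<open>s\<close> legitimate. If the sum contains the negative
  parameter, the omitted ones are positive and the sum is at most the negative total; otherwise all
  its terms are positive.\<close>

lemma orthocentric_params_partial_sum_nonzero:
  assumes "orthocentric_params d lam" "I \<subseteq> {1..d}"
  shows "lam 0 + (\<Sum>i\<in>I. lam i) \<noteq> 0"
proof -
  let ?J = "insert 0 I"
  have J: "?J \<subseteq> {0..d}" "finite ?J" using assms(2) finite_subset by fastforce+
  have "0 \<notin> I" using assms(2) by auto
  then have sum_J: "(\<Sum>i\<in>?J. lam i) = lam 0 + (\<Sum>i\<in>I. lam i)" using J(2) by simp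
  have pos: "0 < (\<Sum>i\<in>?J. lam i)" if "\<And>i. i \<in> ?J \<Longrightarrow> 0 < lam i"
    using J(2) that by (intro sum_pos) auto
  consider "\<forall>i\<in>{0..d}. lam i > 0"
    | j where "j \<in> {0..d}" "\<forall>i\<in>{0..d}. i \<noteq> j \<longrightarrow> lam i > 0" "(\<Sum>i=0..d. lam i) < 0"
    using assms(1) unfolding orthocentric_params_def by blast
  then show ?thesis
  proof cases
    case 1
    then show ?thesis using pos J(1) sum_J by fastforce
  next
    case 2
    show ?thesis
    proof (cases "j \<in> ?J")
      case True
      have "0 \<le> (\<Sum>i\<in>{0..d} - ?J. lam i)"
        using 2(2) True by (intro sum_nonneg) (auto intro!: less_imp_le)
      then have "(\<Sum>i\<in>?J. lam i) < 0"
        using 2(3) sum.subset_diff[OF J(1), of lam] by simp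
      then show ?thesis using sum_J by simp
    next
      case False
      then have "0 < lam i" if "i \<in> ?J" for i using 2(2) J(1) that by (metis subsetD)
      then have "0 < (\<Sum>i\<in>?J. lam i)" by (rule pos)
      then show ?thesis using sum_J by simp
    qed
  qed
qed

text \<open>
  The vector \<open>c\<close> is the orthogonal projection onto the span of \<open>v ` I\<close> of every \<open>v j\<close> with
  \<open>j \<notin> I\<close>, and the vectors \<open>lam i *\<^sub>R (v i - c)\<close>, \<open>i \<in> I\<close>, form the basis of this span dual to
  \<open>v i\<close>, \<open>i \<in> I\<close>. So one and the same shift produces both factors.
\<close>

locale orthocentric_shift =
  fixes v :: "'i \<Rightarrow> 'a::euclidean_space" and l0 s :: real and lam :: "'i \<Rightarrow> real" and D I :: "'i set" and c :: 'a
  assumes gram: "\<And>i j. i \<in> D \<Longrightarrow> j \<in> D \<Longrightarrow> v i \<bullet> v j = inv_weight_matrix l0 lam i j"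
    and fin: "finite I" and I: "I \<subseteq> D"
    and nz: "l0 \<noteq> 0" "\<And>i. i \<in> D \<Longrightarrow> lam i \<noteq> 0" "s \<noteq> 0"
    and s_def: "s = l0 + (\<Sum>i\<in>I. lam i)"
    and c_def: "c = (1 / s) *\<^sub>R (\<Sum>i\<in>I. lam i *\<^sub>R v i)"
begin

lemma shift_in_span: "c \<in> span (v ` I)"
  unfolding c_def by (intro span_scale span_sum) (auto intro: span_base)

text \<open>For \<open>k\<close> in \<open>I\<close> the value \<open>1 / l0\<close> is also the
  inner product of \<open>v k\<close> with every \<open>v j\<close> outside \<open>I\<close>. As
  \<open>c\<close> lies in the span of the face, this makes it the projection of each such
  \<open>v j\<close>.\<close>

lemma shift_inner: "j \<in> D \<Longrightarrow> c \<bullet> v j = (if j \<in> I then 1 / l0 else 1 / l0 - 1 / s)"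
proof -
  assume j: "j \<in> D"
  have "(\<Sum>i\<in>I. lam i * (v i \<bullet> v j)) = (\<Sum>i\<in>I. lam i / l0 + (if i = j then 1 else 0))"
    using I j nz(2) by (intro sum.cong) (auto simp: gram inv_weight_matrix_def distrib_left)
  also have "\<dots> = (s - l0) / l0 + (if j \<in> I then 1 else 0)"
    using fin by (simp add: sum.distrib s_def sum_divide_distrib)
  finally show ?thesis
    using nz(1,3) by (auto simp: c_def inner_sum_left field_simps)
qed

lemma shift_norm: "c \<bullet> c = 1 / l0 - 1 / s"
proof -
  have "c \<bullet> c = (1 / s) * (\<Sum>i\<in>I. lam i * (c \<bullet> v i))"
    by (subst (2) c_def) (simp add: inner_sum_right)
  also have "(\<Sum>i\<in>I. lam i * (c \<bullet> v i)) = (\<Sum>i\<in>I. lam i / l0)"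
    using I by (intro sum.cong) (auto simp: shift_inner)
  also have "\<dots> = (s - l0) / l0" by (simp add: s_def sum_divide_distrib)
  finally show ?thesis using nz(1,3) by (simp add: field_simps)
qed

text \<open>The shift changes only the constant part \<open>1 / l0\<close> of the Gram matrix: it
  becomes \<open>- 1 / s\<close> within \<open>I\<close>, \<open>1 / s\<close> outside
  \<open>I\<close>, and 0 between the two. This is the origin of the first arguments of both
  \<open>gfun\<close> factors.\<close>

lemma gram_shifted:
  assumes "i \<in> D" "j \<in> D"
  shows "(v i - c) \<bullet> (v j - c) =
    (if i \<in> I \<and> j \<in> I then inv_weight_matrix (- s) lam i j
     else if i \<notin> I \<and> j \<notin> I then inv_weight_matrix s lam i j
     else 0)"
proof -
  have "(v i - c) \<bullet> (v j - c) = v i \<bullet> v j - c \<bullet> v i - c \<bullet> v j + c \<bullet> c"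
    by (simp add: inner_simps inner_commute)
  then show ?thesis
    using assms by (auto simp: shift_norm shift_inner gram inv_weight_matrix_def)
qed

lemma shifted_inner:
  assumes "i \<in> D" "k \<in> I"
  shows "(v i - c) \<bullet> v k = (if i = k then 1 / lam i else 0)"
  using assms I by (auto simp: inner_diff_left shift_inner gram inv_weight_matrix_def)

end

text \<open>Negating the vectors of \<open>I\<close> keeps their Gram matrix and turns the
  positivity conditions into the negativity conditions of \<open>gfun\<close>. Of the factor
  \<open>lam i\<close> only the sign matters, which explains the \<open>sgn\<close>.\<close>

lemma measure_orthant_split:
  fixes u :: "'i \<Rightarrow> 'a::euclidean_space"
  assumes fin: "finite D" and "I \<subseteq> D" and u_nz: "\<And>j. j \<in> D - I \<Longrightarrow> u j \<noteq> 0"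
    and eps: "\<And>j. j \<in> D - I \<Longrightarrow> eps j \<noteq> 0" and lam: "\<And>i. i \<in> I \<Longrightarrow> lam i \<noteq> 0"
    and gram_I: "\<And>i j. i \<in> I \<Longrightarrow> j \<in> I \<Longrightarrow> u i \<bullet> u j = inv_weight_matrix a lam i j"
    and gram_J: "\<And>i j. i \<in> D - I \<Longrightarrow> j \<in> D - I \<Longrightarrow> u i \<bullet> u j = inv_weight_matrix b lam i j"
    and orth: "\<And>i j. i \<in> I \<Longrightarrow> j \<in> D - I \<Longrightarrow> u i \<bullet> u j = 0"
  shows "measure std_gaussian {x :: 'a. (\<forall>i\<in>I. 0 < ((eps i * lam i) *\<^sub>R u i) \<bullet> x) \<and>
      (\<forall>j\<in>D - I. (eps j *\<^sub>R u j) \<bullet> x \<le> 0)} =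
    gfun I a lam (\<lambda>i. eps i * sgn (lam i)) * gfun (D - I) b lam eps"
proof -
  let ?G = "std_gaussian :: 'a measure"
  interpret G: prob_space ?G by (rule prob_space_std_gaussian)
  have finI: "finite I" "finite (D - I)" using assms(1,2) finite_subset by auto
  define y where "y k = (if k \<in> I then - u k else u k)" for k
  define f where "f k = (if k \<in> I then eps k * sgn (lam k) else eps k)" for k
  have meas1: "{x. (\<forall>i\<in>I. 0 < ((eps i * lam i) *\<^sub>R u i) \<bullet> x) \<and> (\<forall>j\<in>D - I. (eps j *\<^sub>R u j) \<bullet> x \<le> 0)} \<in> sets borel"
    using finI by measurable
  have finU: "finite (I \<union> (D - I))" using finI by blast
  have meas2: "{x. \<forall>k\<in>I \<union> (D - I). y k \<bullet> x \<in> {t. f k * t < 0}} \<in> sets borel"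
    unfolding mem_Collect_eq using finU by measurable
  \<comment> \<open>Outside finitely many null hyperplanes the weak inequalities for
    \<open>D - I\<close> are strict, as \<open>gfun\<close> demands.\<close>
  have "AE x in ?G. \<forall>j\<in>D - I. u j \<bullet> x \<noteq> 0"
    using finI(2) u_nz by (intro AE_finite_allI std_gaussian_hyperplane_null) auto
  then have "AE x in ?G. x \<in> {x. (\<forall>i\<in>I. 0 < ((eps i * lam i) *\<^sub>R u i) \<bullet> x) \<and>
        (\<forall>j\<in>D - I. (eps j *\<^sub>R u j) \<bullet> x \<le> 0)} \<longleftrightarrow>
      x \<in> {x. \<forall>k\<in>I \<union> (D - I). y k \<bullet> x \<in> {t. f k * t < 0}}"
  proof eventually_elim
    case (elim x)
    have "0 < ((eps i * lam i) *\<^sub>R u i) \<bullet> x \<longleftrightarrow> f i * (y i \<bullet> x) < 0" if "i \<in> I" for i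
    proof -
      have "eps i * lam i * (u i \<bullet> x) = - (\<bar>lam i\<bar> * (f i * (y i \<bullet> x)))"
        using that by (simp add: y_def f_def sgn_if)
      then show ?thesis using lam[OF that] by (simp add: mult_less_0_iff)
    qed
    moreover have "(eps j *\<^sub>R u j) \<bullet> x \<le> 0 \<longleftrightarrow> f j * (y j \<bullet> x) < 0" if "j \<in> D - I" for j
    proof -
      have "eps j * (u j \<bullet> x) \<noteq> 0" using elim eps that by auto
      then show ?thesis using that by (simp add: f_def y_def order_less_le)
    qed
    ultimately show ?case by (auto simp del: inner_scaleR_left)
  qed
  then have "measure ?G {x. (\<forall>i\<in>I. 0 < ((eps i * lam i) *\<^sub>R u i) \<bullet> x) \<and> (\<forall>j\<in>D - I. (eps j *\<^sub>R u j) \<bullet> x \<le> 0)} =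
      measure ?G {x. \<forall>k\<in>I \<union> (D - I). y k \<bullet> x \<in> {t. f k * t < 0}}"
    using meas1 meas2 by (intro G.finite_measure_eq_AE) auto
  also have "\<dots> = measure ?G {x. \<forall>k\<in>I. y k \<bullet> x \<in> {t. f k * t < 0}} *
      measure ?G {x. \<forall>k\<in>D - I. y k \<bullet> x \<in> {t. f k * t < 0}}"
    using finI orth by (intro std_gaussian_orthogonal_indep) (auto simp: y_def)
  also have "measure ?G {x. \<forall>k\<in>I. y k \<bullet> x \<in> {t. f k * t < 0}} = gfun I a lam (\<lambda>i. eps i * sgn (lam i))"
    using finI(1) by (subst gfun_eq_measure_std_gaussian[of I y])
      (auto simp: y_def f_def gram_I intro!: arg_cong[of _ _ "measure ?G"])
  also have "measure ?G {x. \<forall>k\<in>D - I. y k \<bullet> x \<in> {t. f k * t < 0}} = gfun (D - I) b lam eps"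
    using finI(2) by (subst gfun_eq_measure_std_gaussian[of "D - I" y])
      (auto simp: y_def f_def gram_J intro!: arg_cong[of _ _ "measure ?G"])
  finally show ?thesis .
qed

lemma conic_intrinsic_volume_orthocentric:
  fixes C :: "'a::euclidean_space set"
  assumes lam: "\<forall>i\<in>{0..d}. lam i \<noteq> 0" and params: "orthocentric_params d lam"
    and eps: "\<forall>i\<in>{1..d}. eps i \<in> {-1, 1}" and cone: "is_orthocentric_cone d lam eps C"
  shows "conic_intrinsic_volume k C =
    (\<Sum>I | I \<subseteq> {1..d} \<and> card I = k.
       gfun I (- lam 0 - (\<Sum>i\<in>I. lam i)) lam (\<lambda>i. eps i * sgn (lam i)) *
       gfun ({1..d} - I) (lam 0 + (\<Sum>i\<in>I. lam i)) lam eps)"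
proof -
  let ?D = "{1..d}"
  obtain v :: "nat \<Rightarrow> 'a" where v: "inj_on v ?D" "independent (v ` ?D)"
    and gram: "\<And>i j. i \<in> ?D \<Longrightarrow> j \<in> ?D \<Longrightarrow> v i \<bullet> v j = inv_weight_matrix (lam 0) lam i j"
    and C_v: "C = convex_cone hull ((\<lambda>i. eps i *\<^sub>R v i) ` ?D)"
    using cone unfolding is_orthocentric_cone_def by blast
  define e where "e i = eps i *\<^sub>R v i" for i
  obtain \<psi> where \<psi>: "simplicial_cone ?D v \<psi>" using simplicial_cone_exists[OF _ v] by blast
  interpret V: simplicial_cone ?D v \<psi> by (rule \<psi>)
  have eps_sq: "eps i * eps i = 1" "eps i \<noteq> 0" if "i \<in> ?D" for i using eps that by force+
  \<comment> \<open>Since \<open>eps i\<close> squares to 1, scaling the functionals by the same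
    signs as the generators preserves duality.\<close>
  have "linear (\<lambda>x. eps i * \<psi> i x)" for i
    using linear_compose_scale_right[OF V.linear_\<phi>[of i], of "eps i"] by simp
  moreover have "eps i * \<psi> i (e j) = (if i = j then 1 else 0)" if "i \<in> ?D" "j \<in> ?D" for i j
    using that eps_sq[of j] V.\<phi>_e[OF that] by (simp add: e_def linear_cmul[OF V.linear_\<phi>])
  ultimately have "simplicial_cone ?D e (\<lambda>i x. eps i * \<psi> i x)"
    by (simp add: simplicial_cone_def)
  then interpret E: simplicial_cone ?D e "\<lambda>i x. eps i * \<psi> i x" .
  have C: "C = E.cone_of ?D" unfolding C_v e_def ..
  have l0: "lam 0 \<noteq> 0" and lamD: "\<And>i. i \<in> ?D \<Longrightarrow> lam i \<noteq> 0" using lam by auto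
  have summand: "measure std_gaussian {x. closest_point C x \<in> rel_interior (E.cone_of I)} =
      gfun I (- lam 0 - (\<Sum>i\<in>I. lam i)) lam (\<lambda>i. eps i * sgn (lam i)) *
      gfun (?D - I) (lam 0 + (\<Sum>i\<in>I. lam i)) lam eps" if I: "I \<subseteq> ?D" for I
  proof -
    have finI: "finite I" using I finite_subset by blast
    define s where "s = lam 0 + (\<Sum>i\<in>I. lam i)"
    have s: "lam 0 + (\<Sum>i\<in>I. lam i) \<noteq> 0"
      using orthocentric_params_partial_sum_nonzero[OF params I] .
    define c where "c = (1 / s) *\<^sub>R (\<Sum>i\<in>I. lam i *\<^sub>R v i)"
    interpret S: orthocentric_shift v "lam 0" s lam ?D I c
      using gram finI I l0 lamD s by unfold_locales (auto simp: s_def c_def)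
    define u where "u i = v i - c" for i
    note g = S.gram_shifted[folded u_def]
    note inner = S.shifted_inner[folded u_def]
    have "v i \<in> span (e ` I)" if "i \<in> I" for i
    proof -
      have "v i = eps i *\<^sub>R e i" using eps_sq(1)[of i] I that by (auto simp: e_def)
      then show ?thesis using that by (metis imageI span_base span_scale)
    qed
    then have "v ` I \<subseteq> span (e ` I)" by blast
    then have span: "span (v ` I) \<subseteq> span (e ` I)" by (rule span_minimal) simp
    have shift: "c \<in> span (e ` I)"
      using S.shift_in_span span by blast
    \<comment> \<open>The dual vectors are \<open>(eps i * lam i) *\<^sub>R u i\<close>, because
      \<open>u i \<bullet> e i\<close> equals \<open>eps i / lam i\<close>; the residual of
      \<open>e j\<close> is \<open>eps j *\<^sub>R u j\<close>.\<close>
    have closest: "closest_point C x \<in> rel_interior (E.cone_of I) \<longleftrightarrow>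
        (\<forall>i\<in>I. 0 < ((eps i * lam i) *\<^sub>R u i) \<bullet> x) \<and> (\<forall>j\<in>?D - I. (eps j *\<^sub>R u j) \<bullet> x \<le> 0)" for x
      unfolding C
    proof (rule E.closest_point_in_rel_interior_iff[OF I])
      fix i assume i: "i \<in> I"
      show "(eps i * lam i) *\<^sub>R u i \<in> span (e ` I)"
        unfolding u_def using i span shift by (intro span_scale span_diff) (auto intro: span_base)
      fix k assume k: "k \<in> I"
      have "((eps i * lam i) *\<^sub>R u i) \<bullet> e k = eps i * lam i * (eps k * (u i \<bullet> v k))"
        by (simp add: e_def)
      also have "\<dots> = (if i = k then 1 else 0)"
        using i k I inner[of i k] lamD[of i] eps_sq[of i] by (auto simp: subset_iff)
      finally show "((eps i * lam i) *\<^sub>R u i) \<bullet> e k = (if i = k then 1 else 0)" .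
    next
      fix j assume j: "j \<in> ?D - I"
      have "e j - eps j *\<^sub>R u j = eps j *\<^sub>R c"
        by (simp add: e_def u_def scaleR_diff_right)
      then show "e j - eps j *\<^sub>R u j \<in> span (e ` I)" using shift span_scale by metis
      fix k assume "k \<in> I"
      then show "(eps j *\<^sub>R u j) \<bullet> e k = 0" using j inner[of j k] by (auto simp: e_def)
    qed
    \<comment> \<open>As a combination of the \<open>v i\<close> with \<open>i\<close> in
      \<open>I\<close>, the vector \<open>c\<close> has zero coordinate at \<open>j\<close>, whereas
      \<open>v j\<close> has coordinate 1.\<close>
    have u_nz: "u j \<noteq> 0" if j: "j \<in> ?D - I" for j
    proof
      assume "u j = 0"
      then have "\<psi> j (v j) = \<psi> j c" by (simp add: u_def)
      also have "\<dots> = 0" using V.\<phi>_sum[OF I] j by (simp add: c_def linear_cmul[OF V.linear_\<phi>])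
      finally show False using V.\<phi>_e[of j j] j by simp
    qed
    have neg_s: "- lam 0 - (\<Sum>i\<in>I. lam i) = - s" by (simp add: s_def)
    show ?thesis
      unfolding closest neg_s s_def[symmetric]
      by (rule measure_orthant_split) (use I u_nz eps_sq lamD g in \<open>auto simp: subset_iff\<close>)
  qed
  have "conic_intrinsic_volume k C =
      (\<Sum>F \<in> E.cone_of ` {I. I \<subseteq> ?D \<and> card I = k}. measure std_gaussian {x. closest_point C x \<in> rel_interior F})"
    unfolding conic_intrinsic_volume_def C E.faces_eq ..
  also have "\<dots> = (\<Sum>I | I \<subseteq> ?D \<and> card I = k.
      measure std_gaussian {x. closest_point C x \<in> rel_interior (E.cone_of I)})"
    \<comment> \<open>Distinct index sets span distinct faces, so no face is counted twice.\<close>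
    by (subst sum.reindex, rule inj_on_subset[OF E.inj_on_cone_of]) auto
  also have "\<dots> = (\<Sum>I | I \<subseteq> ?D \<and> card I = k.
      gfun I (- lam 0 - (\<Sum>i\<in>I. lam i)) lam (\<lambda>i. eps i * sgn (lam i)) *
      gfun (?D - I) (lam 0 + (\<Sum>i\<in>I. lam i)) lam eps)"
    by (intro sum.cong) (auto simp: summand)
  finally show ?thesis .
qed

theorem corollary5p3:
  fixes d :: nat and lam eps :: "nat \<Rightarrow> real" and C :: "'a::euclidean_space set"
  assumes "d \<ge> 1"
    and "\<forall>i\<in>{0..d}. lam i \<noteq> 0"
    and "orthocentric_params d lam"
    and "\<forall>i\<in>{1..d}. eps i \<in> {-1, 1}"
    and "is_orthocentric_cone d lam eps C"
  shows "(\<forall>k\<in>{0..d}. conic_intrinsic_volume k C =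
            (\<Sum>I | I \<subseteq> {1..d} \<and> card I = k.
               gfun I (- lam 0 - (\<Sum>i\<in>I. lam i)) lam (\<lambda>i. eps i * sgn (lam i)) *
               gfun ({1..d} - I) (lam 0 + (\<Sum>i\<in>I. lam i)) lam eps)) \<and>
         conic_intrinsic_volume 0 C = gfun {1..d} (lam 0) lam eps \<and>
         conic_intrinsic_volume d C =
            gfun {1..d} (- lam 0 - (\<Sum>i=1..d. lam i)) lam (\<lambda>i. eps i * sgn (lam i))"
proof -
  note main = conic_intrinsic_volume_orthocentric[OF assms(2-5)]
  \<comment> \<open>In the two extreme cases there is a single index set, and one of the two factors
    is \<open>gfun\<close> over the empty set, which is 1.\<close>
  have "{I. I \<subseteq> {1..d} \<and> card I = 0} = {{}}"
    by (auto dest: finite_subset)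
  moreover have "{I. I \<subseteq> {1..d} \<and> card I = d} = {{1..d}}"
    using card_subset_eq[of "{1..d}"] by auto
  ultimately show ?thesis
    using main[of 0] main[of d] main by (simp add: gfun_def[of "{}"])
qed

end
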